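(* Let $K$ be a field and $m \geq 1$ an integer prime to $\mathrm{char}\, K$. If $K$ is of type $(\mathrm{F}'_m)$, then so is the field $L = K(\!(t)\!)$ of formal Laurent series over $K$.
   Context: Type $(\mathrm{F}'_m)$: for a field $K$ and an integer $m \geq 1$ prime to $\mathrm{char}\, K$, the field $K$ is said to be of type $(\mathrm{F}'_m)$ if for every finite separable extension $L/K$, the quotient $L^{\times}/{L^{\times}}^m$ of the multiplicative group $L^{\times}$ by the subgroup of $m$-th powers is finite. *)

theory Defs
  imports
    "HOL-Algebra.Algebraic_Closure_Type"
    "HOL-Algebra.Multiplicative_Group"
    "HOL-Algebra.Weak_Morphisms"
    "HOL-Computational_Algebra.Formal_Laurent_Series"
begin

text \<open>
  The base field is a type of class \<open>field\<close>; an extension field of it is a field \<open>L\<close> of HOL-Algebra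
  together with a ring homomorphism \<open>h\<close> from the base field to \<open>L\<close>.
\<close>

definition field_extension :: "('a::field \<Rightarrow> 'b) \<Rightarrow> ('b, 'c) ring_scheme \<Rightarrow> bool" where
  "field_extension h L \<longleftrightarrow>
     Ring.field L \<and> h \<in> ring_hom (ring_of_type_algebra :: 'a ring) L"

definition finite_field_extension :: "('a::field \<Rightarrow> 'b) \<Rightarrow> ('b, 'c) ring_scheme \<Rightarrow> bool" where
  "finite_field_extension h L \<longleftrightarrow>
     field_extension h L \<and> ring.finite_dimension L (range h) (carrier L)"

definition poly_value ::
    "('a::field \<Rightarrow> 'b) \<Rightarrow> ('b, 'c) ring_scheme \<Rightarrow> 'a Polynomial.poly \<Rightarrow> 'b \<Rightarrow> 'b" where
  "poly_value h L p x =
     (\<Oplus>\<^bsub>L\<^esub>i\<in>{..Polynomial.degree p}. h (Polynomial.coeff p i) \<otimes>\<^bsub>L\<^esub> x [^]\<^bsub>L\<^esub> i)"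

text \<open>
  An irreducible polynomial vanishing at \<open>x\<close> is the minimal polynomial of \<open>x\<close> up to a constant
  factor, and a polynomial is separable when it is coprime to its derivative.
\<close>

definition separable_element ::
    "('a::field \<Rightarrow> 'b) \<Rightarrow> ('b, 'c) ring_scheme \<Rightarrow> 'b \<Rightarrow> bool" where
  "separable_element h L x \<longleftrightarrow>
     (\<exists>p. Factorial_Ring.irreducible p \<and> Rings.coprime p (Polynomial.pderiv p) \<and>
          poly_value h L p x = \<zero>\<^bsub>L\<^esub>)"

definition finite_separable_extension ::
    "('a::field \<Rightarrow> 'b) \<Rightarrow> ('b, 'c) ring_scheme \<Rightarrow> bool" where
  "finite_separable_extension h L \<longleftrightarrow>
     finite_field_extension h L \<and> (\<forall>x\<in>carrier L. separable_element h L x)"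

definition mth_powers :: "('b, 'c) ring_scheme \<Rightarrow> nat \<Rightarrow> 'b set" where
  "mth_powers L m = (\<lambda>x. x [^]\<^bsub>L\<^esub> m) ` carrier (mult_of L)"

definition power_classes :: "('b, 'c) ring_scheme \<Rightarrow> nat \<Rightarrow> 'b set monoid" where
  "power_classes L m = mult_of L Mod mth_powers L m"

text \<open>
  In characteristic \<open>0\<close>, every \<open>m \<ge> 1\<close> is prime to the characteristic, whereas
  \<open>coprime m 0\<close> holds only for \<open>m = 1\<close>.
\<close>

definition prime_to_char :: "'a::field itself \<Rightarrow> nat \<Rightarrow> bool" where
  "prime_to_char _ m \<longleftrightarrow> CHAR('a) = 0 \<or> Rings.coprime m CHAR('a)"

text \<open>
  A formula cannot quantify over the type of the elements of \<open>L\<close>. Every extension of degree \<open>n\<close> has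
  an isomorphic copy whose elements are lists of \<open>n\<close> coordinates, so the type \<open>'a list\<close> is large
  enough: the lemma \<open>type_F'D\<close> below gives finiteness for finite separable extensions of any type.
\<close>

definition type_F' :: "'a::field itself \<Rightarrow> nat \<Rightarrow> bool" where
  "type_F' _ m \<longleftrightarrow>
     (\<forall>(L :: 'a list ring) (h :: 'a \<Rightarrow> 'a list).
        finite_separable_extension h L \<longrightarrow> finite (carrier (power_classes L m)))"

lemma ring_of_type_algebra_simps:
  "carrier ring_of_type_algebra = UNIV"
  "monoid.mult ring_of_type_algebra = (*)"
  "one ring_of_type_algebra = 1"
  "zero ring_of_type_algebra = 0"
  "add ring_of_type_algebra = (+)"
  by (auto simp: ring_of_type_algebra_def)

lemma field_extension_subfield:
  fixes h :: "'a::field \<Rightarrow> 'b"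
  assumes "field_extension h L"
  shows "subfield (range h) L"
proof -
  interpret L: Ring.field L
    using assms by (simp add: field_extension_def)
  interpret K: Ring.field "ring_of_type_algebra :: 'a ring"
    by (rule field_from_type_algebra)
  interpret ring_hom_ring "ring_of_type_algebra :: 'a ring" L h
    using assms by (intro ring_hom_ringI2 K.ring_axioms L.ring_axioms)
                   (simp add: field_extension_def)
  have "subfield (h ` carrier (ring_of_type_algebra :: 'a ring)) L"
    using img_is_subfield(2)[OF K.carrier_is_subfield L.one_not_zero] .
  thus ?thesis
    by (simp add: ring_of_type_algebra_simps)
qed

lemma ring_iso_finite_separable_extension:
  fixes h :: "'a::field \<Rightarrow> 'b" and s :: "'b \<Rightarrow> 'd"
    and L :: "('b, 'c) ring_scheme" and M :: "('d, 'e) ring_scheme"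
  assumes ext: "finite_separable_extension h L"
    and iso: "s \<in> ring_iso L M" and M: "Ring.field M"
  shows "finite_separable_extension (s \<circ> h) M"
proof -
  have hL: "field_extension h L"
    and dim: "ring.finite_dimension L (range h) (carrier L)"
    and sep: "\<And>x. x \<in> carrier L \<Longrightarrow> separable_element h L x"
    using ext by (auto simp: finite_separable_extension_def finite_field_extension_def)
  interpret L: Ring.field L
    using hL by (simp add: field_extension_def)
  interpret M: Ring.field M
    by (fact M)
  have s_hom: "s \<in> ring_hom L M" and s_inj: "inj_on s (carrier L)"
    and s_img: "s ` carrier L = carrier M"
    using iso by (auto simp: ring_iso_def bij_betw_def)
  interpret sr: ring_hom_ring L M s
    by (intro ring_hom_ringI2 L.ring_axioms M.ring_axioms s_hom)
  interpret s: ring_hom_cring L M s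
    by unfold_locales (rule s_hom)
  have h_closed: "h a \<in> carrier L" for a
    using hL by (auto simp: field_extension_def ring_hom_def ring_of_type_algebra_simps)
  have "s \<circ> h \<in> ring_hom ring_of_type_algebra M"
    using hL h_closed by (auto simp: field_extension_def ring_hom_def ring_of_type_algebra_simps)
  hence fe: "field_extension (s \<circ> h) M"
    by (simp add: field_extension_def M)
  obtain n where "L.dimension n (range h) (carrier L)"
    using dim by (auto simp: L.finite_dimension_def)
  from sr.inj_hom_dimension[OF field_extension_subfield[OF hL] M.one_not_zero s_inj this]
  have "M.dimension n (range (s \<circ> h)) (carrier M)"
    by (simp add: s_img image_comp)
  hence fin: "finite_field_extension (s \<circ> h) M"
    using fe by (auto simp: finite_field_extension_def M.finite_dimension_def)
  have "separable_element (s \<circ> h) M y" if "y \<in> carrier M" for y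
  proof -
    obtain x where x: "x \<in> carrier L" "y = s x"
      using \<open>y \<in> carrier M\<close> s_img by auto
    obtain p where p: "Factorial_Ring.irreducible p" "Rings.coprime p (Polynomial.pderiv p)"
      "poly_value h L p x = \<zero>\<^bsub>L\<^esub>"
      using sep[OF x(1)] by (auto simp: separable_element_def)
    have "poly_value (s \<circ> h) M p y = s (poly_value h L p x)"
      unfolding poly_value_def
      by (subst s.hom_finsum) (auto simp: x h_closed sr.hom_nat_pow o_def intro!: M.finsum_cong')
    thus ?thesis
      using p by (auto simp: separable_element_def)
  qed
  thus ?thesis
    using fin by (simp add: finite_separable_extension_def)
qed

lemma ring_iso_finite_power_classes:
  fixes L :: "('b, 'c) ring_scheme" and M :: "('d, 'e) ring_scheme"
  assumes L: "Ring.field L" and M: "Ring.field M" and iso: "s \<in> ring_iso L M"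
    and fin: "finite (carrier (power_classes M m))"
  shows "finite (carrier (power_classes L m))"
proof -
  interpret L: Ring.field L by (fact L)
  interpret M: Ring.field M by (fact M)
  have s_hom: "s \<in> ring_hom L M" and s_inj: "inj_on s (carrier L)"
    and s_img: "s ` carrier L = carrier M"
    using iso by (auto simp: ring_iso_def bij_betw_def)
  interpret sr: ring_hom_ring L M s
    by (intro ring_hom_ringI2 L.ring_axioms M.ring_axioms s_hom)
  have "s ` (carrier L - {\<zero>\<^bsub>L\<^esub>}) = s ` carrier L - s ` {\<zero>\<^bsub>L\<^esub>}"
    using s_inj by (intro inj_on_image_set_diff) auto
  hence units: "s ` carrier (mult_of L) = carrier (mult_of M)"
    by (simp add: s_img)
  have powers_closed: "mth_powers L m \<subseteq> carrier L"
    by (auto simp: mth_powers_def)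
  have "s ` mth_powers L m = (\<lambda>x. s x [^]\<^bsub>M\<^esub> m) ` carrier (mult_of L)"
    unfolding mth_powers_def image_image by (intro image_cong) (auto simp: sr.hom_nat_pow)
  also have "\<dots> = mth_powers M m"
    unfolding mth_powers_def units[symmetric] by (simp only: image_image)
  finally have powers: "s ` mth_powers L m = mth_powers M m" .
  have coset: "s ` (mth_powers L m #>\<^bsub>mult_of L\<^esub> a) = mth_powers M m #>\<^bsub>mult_of M\<^esub> s a"
    if "a \<in> carrier (mult_of L)" for a
  proof -
    have "s (y \<otimes>\<^bsub>L\<^esub> a) = s y \<otimes>\<^bsub>M\<^esub> s a" if "y \<in> mth_powers L m" for y
      using that \<open>a \<in> _\<close> powers_closed by (intro sr.hom_mult) auto
    hence "(\<lambda>y. s (y \<otimes>\<^bsub>L\<^esub> a)) ` mth_powers L m = (\<lambda>y. y \<otimes>\<^bsub>M\<^esub> s a) ` (s ` mth_powers L m)"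
      unfolding image_image by (intro image_cong) auto
    thus ?thesis
      by (simp add: r_coset_def image_UN image_image powers[symmetric] UNION_singleton_eq_range)
  qed
  have sub: "C \<subseteq> carrier L" if "C \<in> carrier (power_classes L m)" for C
    using that powers_closed
    by (auto simp: power_classes_def FactGroup_def RCOSETS_def r_coset_def)
  have "inj_on (image s) (carrier (power_classes L m))"
    using inj_on_image_eq_iff[OF s_inj] sub by (auto intro!: inj_onI)
  moreover have "image s ` carrier (power_classes L m) \<subseteq> carrier (power_classes M m)"
  proof safe
    fix C assume "C \<in> carrier (power_classes L m)"
    then obtain a where a: "a \<in> carrier (mult_of L)" "C = mth_powers L m #>\<^bsub>mult_of L\<^esub> a"
      unfolding power_classes_def FactGroup_def RCOSETS_def by auto
    have "s a \<in> carrier (mult_of M)"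
      using a(1) units by blast
    thus "s ` C \<in> carrier (power_classes M m)"
      unfolding a(2) coset[OF a(1)] power_classes_def FactGroup_def RCOSETS_def by auto
  qed
  ultimately show ?thesis
    using fin by (metis inj_on_finite)
qed

lemma finite_extension_inj_list:
  fixes h :: "'a::field \<Rightarrow> 'b"
  assumes ext: "finite_field_extension h L"
  obtains g :: "'b \<Rightarrow> 'a list" where "inj_on g (carrier L)"
proof -
  have hL: "field_extension h L"
    and dim: "ring.finite_dimension L (range h) (carrier L)"
    using ext by (auto simp: finite_field_extension_def)
  interpret L: Ring.field L
    using hL by (simp add: field_extension_def)
  have K: "subfield (range h) L"
    using hL by (rule field_extension_subfield)
  obtain n where "L.dimension n (range h) (carrier L)"
    using dim by (auto simp: L.finite_dimension_def)
  from L.exists_base[OF K this]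
  obtain Us where Us: "set Us \<subseteq> carrier L" "L.Span (range h) Us = carrier L"
    by auto
  have "\<exists>ks. v = L.combine (map h ks) Us" if v: "v \<in> carrier L" for v
  proof -
    obtain Ks where Ks: "set Ks \<subseteq> range h" "v = L.combine Ks Us"
      using v Us L.Span_eq_combine_set[OF K Us(1)] by auto
    have "map h (map (inv_into UNIV h) Ks) = Ks"
      using Ks(1) by (auto simp: f_inv_into_f subset_iff intro!: map_idI)
    thus ?thesis
      using Ks(2) by metis
  qed
  then obtain g where "\<And>v. v \<in> carrier L \<Longrightarrow> v = L.combine (map h (g v)) Us"
    by metis
  hence "inj_on g (carrier L)"
    by (metis inj_onI)
  thus ?thesis
    by (rule that)
qed

lemma type_F'D:
  fixes h :: "'a::field \<Rightarrow> 'b" and L :: "('b, 'c) ring_scheme"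
  assumes "type_F' TYPE('a) m" and ext: "finite_separable_extension h L"
  shows "finite (carrier (power_classes L m))"
proof -
  have L: "Ring.field L" and fe: "finite_field_extension h L"
    using ext
    by (auto simp: finite_separable_extension_def finite_field_extension_def field_extension_def)
  obtain g :: "'b \<Rightarrow> 'a list" where g: "inj_on g (carrier L)"
    using finite_extension_inj_list[OF fe] .
  have M: "Ring.field (image_ring g L)" and iso: "g \<in> ring_iso L (image_ring g L)"
    using field.inj_imp_image_ring_is_field[OF L g] inj_imp_image_ring_iso[OF g] by auto
  have "finite_separable_extension (g \<circ> h) (image_ring g L)"
    using ring_iso_finite_separable_extension[OF ext iso M] .
  hence "finite (carrier (power_classes (image_ring g L) m))"
    using assms(1) unfolding type_F'_def by blast
  thus ?thesis
    by (rule ring_iso_finite_power_classes[OF L M iso])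
qed

end

theory Submission
  imports Defs
begin

text \<open>
  Let \<open>T\<close> be a finite extension of \<open>K((t))\<close>. It carries a complete filtration by the multiples of a
  lattice. Its power-bounded elements form an integrally closed local ring \<open>A\<close>, whose maximal ideal
  \<open>M\<close> consists of the topologically nilpotent elements, and a lemma of Kaplansky makes \<open>A\<close> a
  valuation ring. The value group of \<open>K((t))\<close> has finite index in that of \<open>T\<close>, and \<open>1 + M\<close>
  consists of \<open>m\<close>-th powers by Hensel's lemma, so the problem is reduced to the residue field \<open>A/M\<close>.
  That field is finite over \<open>K\<close>, but possibly inseparable. In characteristic \<open>p\<close>, the subfield
  spanned over \<open>K\<close> by its \<open>p\<close>-th powers is then smaller, and passing to it loses no
  \<open>m\<close>-th power classes because \<open>p\<close> is prime to \<open>m\<close>; by induction one arrives at a separable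
  extension of \<open>K\<close>.

  To compute in a type of class \<open>field\<close>, every finite extension is first embedded into the algebraic
  closure of its base field.
\<close>

section \<open>Embedding finite extensions into the algebraic closure\<close>

text \<open>The residue extension can be inseparable even when the extension of
  \<open>K((t))\<close> is separable: in characteristic \<open>p\<close>, if \<open>a\<close> in
  \<open>K\<close> is not a \<open>p\<close>-th power, a root of \<open>X^p - t X - a\<close> has a
  \<open>p\<close>-th root of \<open>a\<close> as its residue. The assumption on \<open>K\<close>
  speaks of separable extensions only, so it cannot be applied to \<open>A/M\<close> directly. What
  makes the descent to \<open>p\<close>-th powers harmless is an identity
  \<open>p u = m w + 1\<close>, which recovers \<open>x\<close> from \<open>x^p\<close> up to
  \<open>m\<close>-th powers. No absolute value on \<open>T\<close> is constructed. The lattice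
  filtration is merely submultiplicative, so all ring-theoretic facts about \<open>A\<close> come
  from boundedness of subrings. Locality is the delicate one: every element of \<open>A\<close> is
  algebraic over \<open>K\<close> modulo \<open>M\<close>, and Hensel's lemma excludes nontrivial
  idempotents there. The degree of the residue field and the index of the value groups are both
  bounded by the dimension of \<open>T\<close> over \<open>K((t))\<close>: a linear relation can be
  scaled until some coefficient is a unit of \<open>K[[t]]\<close>, and inequivalent values force
  linear independence. Representatives of the classes of \<open>T\<close> are then products of one
  for the value group, a power \<open>t^s\<close> with \<open>0 <= s < m\<close>, and a lift from
  the residue field.\<close>

lemma eval_ring_of_type_algebra:
  fixes x :: "'d::field"
  shows "ring.eval ring_of_type_algebra xs x = poly (Poly (rev xs)) x"
proof -
  interpret D: Ring.field "ring_of_type_algebra :: 'd ring"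
    by (rule field_from_type_algebra)
  have [simp]: "y [^]\<^bsub>ring_of_type_algebra\<^esub> n = y ^ n" for y :: 'd and n :: nat
    by (induction n) (auto simp: ring_of_type_algebra_simps)
  show ?thesis
    by (induction xs) (auto simp: ring_of_type_algebra_simps Poly_append poly_monom)
qed

text \<open>\<open>x\<close> is sent to a root \<open>b\<close> of the image of its minimal
  polynomial. Evaluation at \<open>b\<close> kills every multiple of that polynomial, hence
  everything that vanishes at \<open>x\<close>, and so descends from \<open>K[X]\<close> to the
  simple extension.\<close>

lemma (in domain) extend_hom_simple_extension:
  fixes g :: "'a \<Rightarrow> 'd::alg_closed_field"
  assumes K: "subfield K R" and g: "g \<in> ring_hom (R\<lparr>carrier := K\<rparr>) ring_of_type_algebra"
    and x: "x \<in> carrier R" and alg: "(algebraic over K) x"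
  obtains g' where "g' \<in> ring_hom (R\<lparr>carrier := simple_extension K x\<rparr>) ring_of_type_algebra"
    "\<And>k. k \<in> K \<Longrightarrow> g' k = g k"
proof -
  let ?D = "ring_of_type_algebra :: 'd ring"
  interpret D: Ring.field ?D
    by (rule field_from_type_algebra)
  have sK: "subring K R"
    using K by (rule subfieldE(1))
  have fK: "Ring.field (R\<lparr>carrier := K\<rparr>)"
    using K subfield_iff(2) by blast
  interpret RK: Ring.field "R\<lparr>carrier := K\<rparr>"
    by (rule fK)
  interpret g: ring_hom_ring "R\<lparr>carrier := K\<rparr>" ?D g
    by (intro ring_hom_ringI2 RK.ring_axioms D.ring_axioms g)
  interpret KX: principal_domain "K[X]"
    using univ_poly_is_principal[OF K] .
  define p where "p = Irr K x"
  note p = IrrE[OF K x alg, folded p_def]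
  have set_K: "set q \<subseteq> K" if "q \<in> carrier (K[X])" for q
    using that polynomial_incl univ_poly_carrier by blast
  have coeffs_D: "set ys \<subseteq> carrier ?D" for ys :: "'d list"
    by (simp add: ring_of_type_algebra_simps)
  obtain b where b: "D.eval (map g p) b = 0"
  proof -
    have "Polynomials.degree p \<ge> 1"
      using pirreducible_degree[OF K p(1,2)] .
    have ne: "p \<noteq> []"
      using \<open>Polynomials.degree p \<ge> 1\<close> by auto
    hence len: "length p \<ge> 2"
      using \<open>Polynomials.degree p \<ge> 1\<close> by auto
    \<comment> \<open>The leading entry of \<open>p\<close> is 1 and \<open>g\<close> preserves it,
      so the image polynomial keeps its positive degree, as the existence of a root demands.\<close>
    have "Polynomial.coeff (Poly (rev (map g p))) (length p - 1) = g (hd p)"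
      using ne by (simp add: nth_default_def rev_nth hd_conv_nth)
    also have "\<dots> = 1"
      using p(3) ne g.hom_one by (simp add: ring_of_type_algebra_simps)
    finally have "length p - 1 \<le> Polynomial.degree (Poly (rev (map g p)))"
      by (intro le_degree) auto
    hence "Polynomial.degree (Poly (rev (map g p))) > 0"
      using len by linarith
    from alg_closed_imp_poly_has_root[OF this] show ?thesis
      using that unfolding eval_ring_of_type_algebra by auto
  qed
  define E where "E q = D.eval (map g q) b" for q
  have b_D: "b \<in> carrier ?D"
    by (simp add: ring_of_type_algebra_simps)
  have E_mult: "E (q \<otimes>\<^bsub>K[X]\<^esub> r) = E q * E r" if "q \<in> carrier (K[X])" "r \<in> carrier (K[X])" for q r
  proof -
    have "E (q \<otimes>\<^bsub>K[X]\<^esub> r) = D.eval (D.normalize (map g (RK.poly_mult q r))) b"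
      unfolding E_def univ_poly_mult poly_mult_consistent[OF sK]
      by (intro D.eval_normalize[symmetric] coeffs_D b_D)
    also have "D.normalize (map g (RK.poly_mult q r)) = D.poly_mult (map g q) (map g r)"
      using set_K that by (intro g.poly_mult_hom') auto
    finally show ?thesis
      by (simp add: D.eval_poly_mult[OF coeffs_D coeffs_D b_D] E_def ring_of_type_algebra_simps del: D.poly_mult.simps)
  qed
  have E_add: "E (q \<oplus>\<^bsub>K[X]\<^esub> r) = E q + E r" if "q \<in> carrier (K[X])" "r \<in> carrier (K[X])" for q r
  proof -
    have "E (q \<oplus>\<^bsub>K[X]\<^esub> r) = D.eval (D.normalize (map g (RK.poly_add q r))) b"
      unfolding E_def univ_poly_add poly_add_consistent[OF sK]
      by (intro D.eval_normalize[symmetric] coeffs_D b_D)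
    also have "D.normalize (map g (RK.poly_add q r)) = D.poly_add (map g q) (map g r)"
      using set_K that by (intro g.poly_add_hom') auto
    finally show ?thesis
      by (simp add: D.eval_poly_add[OF coeffs_D coeffs_D b_D] E_def ring_of_type_algebra_simps del: D.poly_add.simps)
  qed
  have E_const: "E (poly_of_const k) = g k" if "k \<in> K" for k
    using that g.hom_zero subring_props(1)[OF K]
    by (auto simp: E_def poly_of_const_def normalize_def ring_of_type_algebra_simps)
  have E_ker: "E q = 0" if q: "q \<in> carrier (K[X])" "eval q x = \<zero>" for q
  proof -
    have "p pdivides q"
      using Irr_minimal[OF K x alg q] by (simp add: p_def)
    hence "p divides\<^bsub>K[X]\<^esub> q"
      using pdivides_iff_shell[OF K p(1) q(1)] by simp
    then obtain s where "s \<in> carrier (K[X])" "q = p \<otimes>\<^bsub>K[X]\<^esub> s"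
      by (auto simp: factor_def)
    thus ?thesis
      using E_mult[OF p(1)] b by (simp add: E_def)
  qed
  interpret ev: ring_hom_ring "K[X]" R "\<lambda>q. eval q x"
    by (rule eval_ring_hom[OF sK x])
  have E_cong: "E q = E r"
    if qr: "q \<in> carrier (K[X])" "r \<in> carrier (K[X])" "eval q x = eval r x" for q r
  proof -
    have "eval (q \<ominus>\<^bsub>K[X]\<^esub> r) x = \<zero>"
      using qr x by (simp add: a_minus_def ev.hom_add ev.hom_a_inv r_neg)
    hence "E (q \<ominus>\<^bsub>K[X]\<^esub> r) = 0"
      using qr by (intro E_ker) auto
    moreover have "q = (q \<ominus>\<^bsub>K[X]\<^esub> r) \<oplus>\<^bsub>K[X]\<^esub> r"
      using qr by (metis KX.add.inv_closed KX.add.m_assoc KX.minus_eq KX.l_neg KX.r_zero)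
    ultimately show ?thesis
      using E_add[of "q \<ominus>\<^bsub>K[X]\<^esub> r" r] qr by simp
  qed
  \<comment> \<open>Any polynomial with value \<open>y\<close> at \<open>x\<close> would do: by
    \<open>E_cong\<close> the choice does not affect \<open>E\<close>.\<close>
  define rep where "rep y = (SOME q. q \<in> carrier (K[X]) \<and> eval q x = y)" for y
  have rep: "rep y \<in> carrier (K[X])" "eval (rep y) x = y" if "y \<in> simple_extension K x" for y
  proof -
    have "\<exists>q. q \<in> carrier (K[X]) \<and> eval q x = y"
      using that simple_extension_as_eval_img[OF subfieldE(3)[OF K] x] by auto
    thus "rep y \<in> carrier (K[X])" "eval (rep y) x = y"
      unfolding rep_def by (metis (mono_tags, lifting) someI_ex)+
  qed
  have sub: "subring (simple_extension K x) R"
    by (rule simple_extension_is_subring[OF sK x])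
  have gk: "E (rep k) = g k" if k: "k \<in> K" for k
  proof -
    have "poly_of_const k \<in> carrier (K[X])"
      using canonical_embedding_is_hom[OF sK] k by (auto simp: ring_hom_def)
    moreover have "eval (poly_of_const k) x = k"
      using k subfieldE(3)[OF K] x by (auto simp: poly_of_const_def normalize_def)
    moreover have "k \<in> simple_extension K x"
      using simple_extension_incl[OF subfieldE(3)[OF K] x] k by auto
    ultimately show ?thesis
      using E_cong[of "rep k" "poly_of_const k"] rep[of k] E_const[OF k] by simp
  qed
  have "(\<lambda>y. E (rep y)) \<in> ring_hom (R\<lparr>carrier := simple_extension K x\<rparr>) ?D"
  proof (rule ring_hom_memI)
    fix y z
    assume "y \<in> carrier (R\<lparr>carrier := simple_extension K x\<rparr>)"
      and "z \<in> carrier (R\<lparr>carrier := simple_extension K x\<rparr>)"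
    hence yz: "y \<in> simple_extension K x" "z \<in> simple_extension K x"
      by auto
    have "E (rep (y \<otimes> z)) = E (rep y \<otimes>\<^bsub>K[X]\<^esub> rep z)"
      using rep yz subringE(6)[OF sub yz] ev.hom_mult by (intro E_cong) auto
    thus "E (rep (y \<otimes>\<^bsub>R\<lparr>carrier := simple_extension K x\<rparr>\<^esub> z)) = E (rep y) \<otimes>\<^bsub>?D\<^esub> E (rep z)"
      using E_mult rep yz by (simp add: ring_of_type_algebra_simps)
    have "E (rep (y \<oplus> z)) = E (rep y \<oplus>\<^bsub>K[X]\<^esub> rep z)"
      using rep yz subringE(7)[OF sub yz] ev.hom_add by (intro E_cong) auto
    thus "E (rep (y \<oplus>\<^bsub>R\<lparr>carrier := simple_extension K x\<rparr>\<^esub> z)) = E (rep y) \<oplus>\<^bsub>?D\<^esub> E (rep z)"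
      using E_add rep yz by (simp add: ring_of_type_algebra_simps)
  next
    show "E (rep \<one>\<^bsub>R\<lparr>carrier := simple_extension K x\<rparr>\<^esub>) = \<one>\<^bsub>?D\<^esub>"
      using gk[OF subringE(3)[OF sK]] g.hom_one by simp
  qed (simp add: ring_of_type_algebra_simps)
  thus thesis
    using gk by (rule that)
qed

section \<open>Finite extensions as subsets of a type of class \<open>field\<close>\<close>

locale field_hom =
  fixes e :: "'k::field \<Rightarrow> 'c::field"
  assumes hom_add: "e (a + b) = e a + e b"
    and hom_mult: "e (a * b) = e a * e b"
    and hom_1 [simp]: "e 1 = 1"
begin

lemma hom_0 [simp]: "e 0 = 0"
  using hom_add[of 0 0] by (metis add_0 add_cancel_left_left)

lemma hom_minus: "e (- a) = - e a"
  using hom_add[of a "- a"] by (simp add: add_eq_0_iff)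

lemma hom_diff: "e (a - b) = e a - e b"
  using hom_add[of a "- b"] by (simp add: hom_minus)

lemma hom_eq_0_iff [simp]: "e a = 0 \<longleftrightarrow> a = 0"
proof
  assume "e a = 0"
  hence "e (a * inverse a) = 0"
    by (simp add: hom_mult)
  thus "a = 0"
    by (cases "a = 0") auto
qed auto

lemma hom_inverse: "e (inverse a) = inverse (e a)"
proof (cases "a = 0")
  case False
  hence "e a * e (inverse a) = 1"
    by (simp flip: hom_mult)
  thus ?thesis
    by (metis inverse_unique)
qed auto

lemma hom_sum: "e (sum f A) = (\<Sum>x\<in>A. e (f x))"
  by (induction A rule: infinite_finite_induct) (auto simp: hom_add)

lemma hom_power: "e (a ^ n) = e a ^ n"
  by (induction n) (auto simp: hom_mult)

lemma hom_of_nat: "e (of_nat n) = of_nat n"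
  by (induction n) (auto simp: hom_add)

sublocale vs: vector_space "\<lambda>a x. e a * x"
  by unfold_locales (auto simp: algebra_simps hom_add hom_mult)

end

text \<open>\<open>inverse_mem\<close> can omit \<open>x \<noteq> 0\<close> because
  \<open>inverse 0 = 0\<close>. A finite spanning set is easier to exhibit than a basis;
  \<open>finite_basis\<close> extracts one later.\<close>

locale finite_subextension = field_hom e
  for e :: "'k::field \<Rightarrow> 'c::field" +
  fixes T :: "'c set"
  assumes base_mem: "e a \<in> T"
    and add_mem: "x \<in> T \<Longrightarrow> y \<in> T \<Longrightarrow> x + y \<in> T"
    and mult_mem: "x \<in> T \<Longrightarrow> y \<in> T \<Longrightarrow> x * y \<in> T"
    and inverse_mem: "x \<in> T \<Longrightarrow> inverse x \<in> T"
    and finite_spanning: "\<exists>B. finite B \<and> B \<subseteq> T \<and> T \<subseteq> vs.span B"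
begin

lemma one_mem: "1 \<in> T"
  using base_mem[of 1] by simp

lemma zero_mem: "0 \<in> T"
  using base_mem[of 0] by simp

lemma minus_mem: "x \<in> T \<Longrightarrow> - x \<in> T"
  using mult_mem[OF base_mem[of "-1"]] by (simp add: hom_minus)

lemma diff_mem: "x \<in> T \<Longrightarrow> y \<in> T \<Longrightarrow> x - y \<in> T"
  using add_mem[OF _ minus_mem] by force

lemma divide_mem: "x \<in> T \<Longrightarrow> y \<in> T \<Longrightarrow> x / y \<in> T"
  using mult_mem[OF _ inverse_mem] by (simp add: field_class.field_divide_inverse)

lemma sum_mem: "(\<And>i. i \<in> I \<Longrightarrow> f i \<in> T) \<Longrightarrow> sum f I \<in> T"
  by (induction I rule: infinite_finite_induct) (auto simp: zero_mem add_mem)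

lemma power_mem: "x \<in> T \<Longrightarrow> x ^ n \<in> T"
  by (induction n) (auto simp: one_mem mult_mem)

lemma subspace_T: "vs.subspace T"
  by (rule vs.subspaceI) (auto simp: zero_mem add_mem mult_mem base_mem)

lemma card_le_dim:
  assumes "vs.independent Y" "Y \<subseteq> T"
  shows "finite Y \<and> card Y \<le> vs.dim T"
proof -
  obtain B where B: "B \<subseteq> T" "vs.independent B" "T \<subseteq> vs.span B" "card B = vs.dim T"
    using vs.basis_exists by metis
  obtain B' where B': "finite B'" "T \<subseteq> vs.span B'"
    using finite_spanning by auto
  have "finite B"
    using vs.independent_span_bound[OF B'(1) B(2)] B B' by auto
  thus ?thesis
    using vs.independent_span_bound[OF _ assms(1), of B] assms(2) B by auto
qed

lemma finite_basis:
  obtains B where "finite B" "B \<subseteq> T" "vs.independent B" "vs.span B = T" "card B = vs.dim T"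
proof -
  obtain B where B: "B \<subseteq> T" "vs.independent B" "T \<subseteq> vs.span B" "card B = vs.dim T"
    using vs.basis_exists by metis
  moreover have "vs.span B \<subseteq> T"
    using vs.span_minimal[OF B(1) subspace_T] .
  ultimately show ?thesis
    using card_le_dim that by (metis subset_antisym)
qed

end

text \<open>A list spanning the extension is adjoined one element at a time, each step prolonging
  the homomorphism into the algebraic closure. The images of that list span the image over the base
  field.\<close>

lemma finite_field_extension_embedding:
  fixes h :: "'k::field \<Rightarrow> 'b"
  assumes "finite_field_extension h L"
  obtains f where "f \<in> ring_hom L (ring_of_type_algebra :: 'k alg_closure ring)"
    "\<And>a. f (h a) = to_ac a" "finite_subextension to_ac (f ` carrier L)"
proof -
  let ?D = "ring_of_type_algebra :: 'k alg_closure ring"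
  have hL: "field_extension h L"
    and dim: "ring.finite_dimension L (range h) (carrier L)"
    using assms by (auto simp: finite_field_extension_def)
  interpret L: Ring.field L
    using hL by (simp add: field_extension_def)
  interpret K: Ring.field "ring_of_type_algebra :: 'k ring"
    by (rule field_from_type_algebra)
  interpret D: Ring.field ?D
    by (rule field_from_type_algebra)
  interpret h: ring_hom_ring "ring_of_type_algebra :: 'k ring" L h
    using hL by (intro ring_hom_ringI2 K.ring_axioms L.ring_axioms)
                (simp add: field_extension_def)
  have K: "subfield (range h) L"
    using hL by (rule field_extension_subfield)
  have h_closed: "h a \<in> carrier L" for a
    using h.hom_closed by (simp add: ring_of_type_algebra_simps)
  have h_inj: "inj h"
    using non_trivial_field_hom_is_inj[OF h.homh K.field_axioms L.field_axioms]
    by (simp add: ring_of_type_algebra_simps)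
  have alg: "(L.algebraic over range h) x" if "x \<in> carrier L" for x
    using L.finite_dimension_imp_algebraic[OF K L.carrier_is_subring dim] that .
  obtain n where "L.dimension n (range h) (carrier L)"
    using dim by (auto simp: L.finite_dimension_def)
  from L.exists_base[OF K this]
  obtain Us where Us: "set Us \<subseteq> carrier L" "L.Span (range h) Us = carrier L"
    by auto
  have "\<exists>M g. subfield M L \<and> range h \<subseteq> M \<and> set xs \<subseteq> M \<and>
      g \<in> ring_hom (L\<lparr>carrier := M\<rparr>) ?D \<and> (\<forall>a. g (h a) = to_ac a)"
    if "set xs \<subseteq> carrier L" for xs
    using that
  proof (induction xs)
    case Nil
    have "(\<lambda>y. to_ac (inv_into UNIV h y)) \<in> ring_hom (L\<lparr>carrier := range h\<rparr>) ?D"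
    proof (rule ring_hom_memI)
      fix y z
      assume "y \<in> carrier (L\<lparr>carrier := range h\<rparr>)" "z \<in> carrier (L\<lparr>carrier := range h\<rparr>)"
      then obtain a b where ab: "y = h a" "z = h b"
        by auto
      have "h (a * b) = h a \<otimes>\<^bsub>L\<^esub> h b" "h (a + b) = h a \<oplus>\<^bsub>L\<^esub> h b"
        using h.hom_mult[of a b] h.hom_add[of a b] by (simp_all add: ring_of_type_algebra_simps)
      thus "to_ac (inv_into UNIV h (y \<otimes>\<^bsub>L\<lparr>carrier := range h\<rparr>\<^esub> z)) =
              to_ac (inv_into UNIV h y) \<otimes>\<^bsub>?D\<^esub> to_ac (inv_into UNIV h z)"
        "to_ac (inv_into UNIV h (y \<oplus>\<^bsub>L\<lparr>carrier := range h\<rparr>\<^esub> z)) =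
              to_ac (inv_into UNIV h y) \<oplus>\<^bsub>?D\<^esub> to_ac (inv_into UNIV h z)"
        using h_inj by (simp_all add: ab ring_of_type_algebra_simps inv_f_eq)
    next
      have "h 1 = \<one>\<^bsub>L\<^esub>"
        using h.hom_one by (simp add: ring_of_type_algebra_simps)
      thus "to_ac (inv_into UNIV h \<one>\<^bsub>L\<lparr>carrier := range h\<rparr>\<^esub>) = \<one>\<^bsub>?D\<^esub>"
        using h_inj by (simp add: ring_of_type_algebra_simps inv_f_eq)
    qed (simp add: ring_of_type_algebra_simps)
    moreover have "to_ac (inv_into UNIV h (h a)) = to_ac a" for a
      using h_inj by simp
    ultimately show ?case
      using K by (intro exI[of _ "range h"] exI[of _ "\<lambda>y. to_ac (inv_into UNIV h y)"]) simp
  next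
    case (Cons x xs)
    then obtain M g where M: "subfield M L" "range h \<subseteq> M" "set xs \<subseteq> M"
      and g: "g \<in> ring_hom (L\<lparr>carrier := M\<rparr>) ?D" "\<And>a. g (h a) = to_ac a"
      by auto
    have x: "x \<in> carrier L"
      using Cons.prems by simp
    have algM: "(L.algebraic over M) x"
      using L.algebraic_mono[OF M(2)] alg[OF x] by (simp add: over_def)
    obtain g' where g': "g' \<in> ring_hom (L\<lparr>carrier := L.simple_extension M x\<rparr>) ?D"
        "\<And>k. k \<in> M \<Longrightarrow> g' k = g k"
      using L.extend_hom_simple_extension[OF M(1) g(1) x algM] by metis
    have incl: "M \<subseteq> L.simple_extension M x" "x \<in> L.simple_extension M x"
      using L.simple_extension_incl[OF subfieldE(3)[OF M(1)] x]
        L.simple_extension_mem[OF subfieldE(1)[OF M(1)] x] by auto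
    have "subfield (L.simple_extension M x) L"
      using L.simple_extension_is_subfield[OF M(1) x] algM by simp
    thus ?case
      using M(2,3) g' incl g(2) rangeI[of h]
      by (intro exI[of _ "L.simple_extension M x"] exI[of _ g']) (auto simp: subset_iff)
  qed
  from this[OF Us(1)] obtain M g where M: "subfield M L" "range h \<subseteq> M" "set Us \<subseteq> M"
    and g: "g \<in> ring_hom (L\<lparr>carrier := M\<rparr>) ?D" "\<And>a. g (h a) = to_ac a"
    by auto
  have carrier_combine: "\<exists>Ks. set Ks \<subseteq> range h \<and> x = L.combine Ks Us" if "x \<in> carrier L" for x
  proof -
    have "x \<in> {L.combine Ks Us | Ks. set Ks \<subseteq> range h}"
      using that L.Span_eq_combine_set[OF K Us(1)] Us(2) by argo
    thus ?thesis
      by auto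
  qed
  have combine_M: "L.combine Ks Vs \<in> M" if "set Ks \<subseteq> M" "set Vs \<subseteq> M" for Ks Vs
    using that
  proof (induction Ks Vs rule: L.combine.induct)
    case (1 k Ks u Us)
    thus ?case
      using subringE(6,7)[OF subfieldE(1)[OF M(1)]] by simp
  qed (use subringE(2)[OF subfieldE(1)[OF M(1)]] in simp_all)
  have "M = carrier L"
  proof
    show "M \<subseteq> carrier L"
      using subfieldE(3)[OF M(1)] .
    show "carrier L \<subseteq> M"
    proof
      fix x assume "x \<in> carrier L"
      then obtain Ks where "set Ks \<subseteq> range h" "x = L.combine Ks Us"
        using carrier_combine by metis
      thus "x \<in> M"
        using combine_M M by auto
    qed
  qed
  hence hom: "g \<in> ring_hom L ?D"
    using g(1) by simp
  interpret g: ring_hom_ring L ?D g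
    by (intro ring_hom_ringI2 L.ring_axioms D.ring_axioms hom)
  have g_simps: "g (x \<otimes>\<^bsub>L\<^esub> y) = g x * g y" "g (x \<oplus>\<^bsub>L\<^esub> y) = g x + g y"
    if "x \<in> carrier L" "y \<in> carrier L" for x y
    using that by (simp_all add: ring_of_type_algebra_simps)
  have g_one: "g \<one>\<^bsub>L\<^esub> = 1" and g_zero: "g \<zero>\<^bsub>L\<^esub> = 0"
    using g.hom_one g.hom_zero by (simp_all add: ring_of_type_algebra_simps)
  interpret ac: field_hom "to_ac :: 'k \<Rightarrow> 'k alg_closure"
    by unfold_locales auto
  have combine_span: "g (L.combine Ks Vs) \<in> ac.vs.span (g ` set Vs)"
    if "set Ks \<subseteq> range h" "set Vs \<subseteq> carrier L" for Ks Vs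
    using that
  proof (induction Ks Vs rule: L.combine.induct)
    case (1 k Ks u Us)
    then obtain a where a: "k = h a"
      by auto
    have carr: "L.combine Ks Us \<in> carrier L" "k \<otimes>\<^bsub>L\<^esub> u \<in> carrier L"
      using 1 h_closed by (auto intro!: L.combine_in_carrier)
    have "g (L.combine (k # Ks) (u # Us)) = to_ac a * g u + g (L.combine Ks Us)"
      using 1(3) carr h_closed by (simp add: a g_simps g(2) ring_of_type_algebra_simps)
    moreover have "g (L.combine Ks Us) \<in> ac.vs.span (g ` set (u # Us))"
      using 1 ac.vs.span_mono[of "g ` set Us" "g ` set (u # Us)"] by auto
    moreover have "g u \<in> ac.vs.span (g ` set (u # Us))"
      by (intro ac.vs.span_base) simp
    ultimately show ?case
      using ac.vs.span_add ac.vs.span_scale by metis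
  qed (auto simp: ring_of_type_algebra_simps ac.vs.span_zero)
  have "finite_subextension to_ac (g ` carrier L)"
  proof
    show "to_ac a \<in> g ` carrier L" for a
      using g(2)[of a] h_closed by (metis image_eqI)
    show "x + y \<in> g ` carrier L" "x * y \<in> g ` carrier L"
      if "x \<in> g ` carrier L" "y \<in> g ` carrier L" for x y
    proof -
      obtain u v where uv: "u \<in> carrier L" "v \<in> carrier L" "x = g u" "y = g v"
        using \<open>x \<in> g ` carrier L\<close> \<open>y \<in> g ` carrier L\<close> by blast
      have "x + y = g (u \<oplus>\<^bsub>L\<^esub> v)" "x * y = g (u \<otimes>\<^bsub>L\<^esub> v)"
        using g_simps[OF uv(1,2)] uv(3,4) by metis+
      thus "x + y \<in> g ` carrier L" "x * y \<in> g ` carrier L"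
        using uv(1,2) by (metis imageI L.a_closed, metis imageI L.m_closed)
    qed
    show "inverse x \<in> g ` carrier L" if "x \<in> g ` carrier L" for x
    proof -
      obtain y where y: "y \<in> carrier L" "x = g y"
        using \<open>x \<in> g ` carrier L\<close> by blast
      show ?thesis
      proof (cases "y = \<zero>\<^bsub>L\<^esub>")
        case False
        hence "y \<in> Units L"
          using y L.field_Units by auto
        hence "g y * g (inv\<^bsub>L\<^esub> y) = 1"
          using g_simps(1)[of y "inv\<^bsub>L\<^esub> y"] g_one y by simp
        hence "inverse x = g (inv\<^bsub>L\<^esub> y)"
          by (simp add: y inverse_unique)
        thus ?thesis
          using \<open>y \<in> Units L\<close> by simp
      next
        case True
        hence "inverse x = g \<zero>\<^bsub>L\<^esub>"
          by (simp only: y g_zero inverse_zero)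
        thus ?thesis
          by blast
      qed
    qed
    have "g x \<in> ac.vs.span (g ` set Us)" if "x \<in> carrier L" for x
      using that combine_span[OF _ Us(1)] carrier_combine by metis
    thus "\<exists>B. finite B \<and> B \<subseteq> g ` carrier L \<and> g ` carrier L \<subseteq> ac.vs.span B"
      using Us(1) by (intro exI[of _ "g ` set Us"]) auto
  qed
  thus ?thesis
    using hom g(2) that by blast
qed

section \<open>Power classes and inseparable extensions\<close>

text \<open>Representatives are used in place of cosets because later ones are given by explicit
  products and powers; they may repeat classes.\<close>

definition finite_power_reps :: "nat \<Rightarrow> 'c::field set \<Rightarrow> bool" where
  "finite_power_reps m T \<longleftrightarrow>
     (\<exists>R. finite R \<and> R \<subseteq> T - {0} \<and> (\<forall>x\<in>T - {0}. \<exists>r\<in>R. \<exists>y\<in>T - {0}. x = r * y ^ m))"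

lemma finite_power_classes_iff:
  assumes "Ring.field L"
  shows "finite (carrier (power_classes L m)) \<longleftrightarrow>
    (\<exists>R. finite R \<and> R \<subseteq> carrier (mult_of L) \<and>
      (\<forall>x\<in>carrier (mult_of L). \<exists>r\<in>R. \<exists>y\<in>carrier (mult_of L). x = y [^]\<^bsub>L\<^esub> m \<otimes>\<^bsub>L\<^esub> r))"
    (is "?lhs \<longleftrightarrow> ?rhs")
proof -
  interpret L: Ring.field L by fact
  have "mult_of L = units_of L"
    using L.field_Units by (simp add: mult_of_def units_of_def)
  hence comm: "comm_group (mult_of L)"
    using L.units_comm_group by simp
  then interpret G: comm_group "mult_of L" .
  let ?H = "mth_powers L m"
  have carr: "carrier (power_classes L m) = (\<lambda>x. ?H #>\<^bsub>mult_of L\<^esub> x) ` carrier (mult_of L)"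
    by (auto simp: power_classes_def FactGroup_def RCOSETS_def)
  have H: "subgroup ?H (mult_of L)"
  proof -
    have "(x \<otimes>\<^bsub>mult_of L\<^esub> y) [^]\<^bsub>mult_of L\<^esub> m = x [^]\<^bsub>mult_of L\<^esub> m \<otimes>\<^bsub>mult_of L\<^esub> y [^]\<^bsub>mult_of L\<^esub> m"
      if "x \<in> carrier (mult_of L)" "y \<in> carrier (mult_of L)" for x y
      using that comm comm_monoid.m_comm[OF comm_group.axioms(1)[OF comm] that]
      by (intro monoid.pow_mult_distrib) (auto simp: comm_group_def comm_monoid_def)
    moreover have "x [^]\<^bsub>mult_of L\<^esub> m \<in> carrier (mult_of L)" if "x \<in> carrier (mult_of L)" for x
      using that comm by (intro monoid.nat_pow_closed) (auto simp: comm_group_def comm_monoid_def)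
    ultimately have "group_hom (mult_of L) (mult_of L) (\<lambda>x. x [^]\<^bsub>mult_of L\<^esub> m)"
      by unfold_locales (auto simp: hom_def simp del: carrier_mult_of mult_mult_of)
    from group_hom.img_is_subgroup[OF this] show ?thesis
      by (simp add: mth_powers_def nat_pow_mult_of)
  qed
  have coset_eq: "?H #>\<^bsub>mult_of L\<^esub> (y [^]\<^bsub>L\<^esub> m \<otimes>\<^bsub>L\<^esub> r) = ?H #>\<^bsub>mult_of L\<^esub> r"
    if "y \<in> carrier (mult_of L)" "r \<in> carrier (mult_of L)" for y r
  proof -
    have "y [^]\<^bsub>L\<^esub> m \<in> ?H"
      using that by (auto simp: mth_powers_def)
    moreover have "y [^]\<^bsub>L\<^esub> m \<in> carrier (mult_of L)"
      using calculation subgroup.subset[OF H] by blast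
    ultimately show ?thesis
      using G.coset_mult_assoc[OF subgroup.subset[OF H], of "y [^]\<^bsub>L\<^esub> m" r]
        G.coset_join2[OF _ H] that by simp
  qed
  show ?thesis
  proof
    assume fin: ?lhs
    define s where "s C = (SOME x. x \<in> carrier (mult_of L) \<and> ?H #>\<^bsub>mult_of L\<^esub> x = C)" for C
    have s: "s C \<in> carrier (mult_of L) \<and> ?H #>\<^bsub>mult_of L\<^esub> s C = C"
      if "C \<in> carrier (power_classes L m)" for C
      using someI_ex[of "\<lambda>x. x \<in> carrier (mult_of L) \<and> ?H #>\<^bsub>mult_of L\<^esub> x = C"] that
      unfolding s_def carr by blast
    have "\<exists>r\<in>s ` carrier (power_classes L m). \<exists>y\<in>carrier (mult_of L). x = y [^]\<^bsub>L\<^esub> m \<otimes>\<^bsub>L\<^esub> r"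
      if x: "x \<in> carrier (mult_of L)" for x
    proof -
      let ?C = "?H #>\<^bsub>mult_of L\<^esub> x"
      have C: "?C \<in> carrier (power_classes L m)"
        using x carr by blast
      have "x \<in> ?H #>\<^bsub>mult_of L\<^esub> s ?C"
        using s[OF C] G.rcos_self[OF x H] by simp
      then obtain y where "y \<in> carrier (mult_of L)" "x = y [^]\<^bsub>L\<^esub> m \<otimes>\<^bsub>L\<^esub> s ?C"
        unfolding r_coset_def mth_powers_def by auto
      thus ?thesis
        using C by blast
    qed
    thus ?rhs
      using fin s by (intro exI[of _ "s ` carrier (power_classes L m)"]) auto
  next
    assume ?rhs
    then obtain R where R: "finite R" "R \<subseteq> carrier (mult_of L)"
      "\<And>x. x \<in> carrier (mult_of L) \<Longrightarrow>
        \<exists>r\<in>R. \<exists>y\<in>carrier (mult_of L). x = y [^]\<^bsub>L\<^esub> m \<otimes>\<^bsub>L\<^esub> r"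
      by blast
    have "carrier (power_classes L m) \<subseteq> (\<lambda>x. ?H #>\<^bsub>mult_of L\<^esub> x) ` R"
    proof
      fix C assume "C \<in> carrier (power_classes L m)"
      then obtain x where x: "x \<in> carrier (mult_of L)" "C = ?H #>\<^bsub>mult_of L\<^esub> x"
        unfolding carr by blast
      obtain r y where "r \<in> R" "y \<in> carrier (mult_of L)" "x = y [^]\<^bsub>L\<^esub> m \<otimes>\<^bsub>L\<^esub> r"
        using R(3)[OF x(1)] by blast
      thus "C \<in> (\<lambda>x. ?H #>\<^bsub>mult_of L\<^esub> x) ` R"
        using coset_eq R(2) x(2) by blast
    qed
    thus ?lhs
      using R(1) finite_surj by blast
  qed
qed

context finite_subextension
begin

abbreviation T_ring :: "'c ring" where
  "T_ring \<equiv> ring_of_type_algebra\<lparr>carrier := T\<rparr>"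

lemma T_ring_field: "Ring.field T_ring"
proof -
  interpret D: Ring.field "ring_of_type_algebra :: 'c ring"
    by (rule field_from_type_algebra)
  have minus: "\<ominus>\<^bsub>ring_of_type_algebra\<^esub> x = - x" for x :: 'c
    using D.minus_equality[of "- x" x] by (simp add: ring_of_type_algebra_simps)
  have inv: "inv\<^bsub>ring_of_type_algebra\<^esub> x = inverse x" if "x \<noteq> 0" for x :: 'c
    using D.comm_inv_char[of x "inverse x"] that by (simp add: ring_of_type_algebra_simps)
  have "subring T ring_of_type_algebra"
    by (rule D.subringI)
       (auto simp: minus ring_of_type_algebra_simps one_mem minus_mem add_mem mult_mem)
  hence "subfield T ring_of_type_algebra"
    by (rule D.subfieldI') (auto simp: ring_of_type_algebra_simps inv inverse_mem)
  thus ?thesis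
    using D.subfield_iff(2) by blast
qed

lemma T_ring_pow: "x [^]\<^bsub>T_ring\<^esub> (n::nat) = x ^ n"
  by (induction n) (auto simp: ring_of_type_algebra_simps)

lemma finite_field_extension_T_ring: "finite_field_extension e T_ring"
proof -
  interpret R: Ring.field T_ring
    by (rule T_ring_field)
  have ext: "field_extension e T_ring"
    by (auto simp: field_extension_def T_ring_field ring_hom_def ring_of_type_algebra_simps
        base_mem hom_add hom_mult)
  note K = field_extension_subfield[OF ext]
  obtain B where B: "finite B" "B \<subseteq> T" "T \<subseteq> vs.span B"
    using finite_spanning by auto
  obtain Us where Us: "set Us = B"
    using B(1) finite_list by auto
  have Us_carr: "set Us \<subseteq> carrier T_ring"
    using B Us by simp
  have add: "x + y \<in> R.Span (range e) Us"
    if "x \<in> R.Span (range e) Us" "y \<in> R.Span (range e) Us" for x y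
    using R.Span_subgroup_props(3)[OF K Us_carr that] by (simp add: ring_of_type_algebra_simps)
  have scale: "e a * x \<in> R.Span (range e) Us" if "x \<in> R.Span (range e) Us" for a x
    using R.Span_smult_closed[OF K Us_carr, of "e a" x] that
    by (simp add: ring_of_type_algebra_simps)
  have zero: "0 \<in> R.Span (range e) Us"
    using R.Span_subgroup_props(2)[OF K Us_carr] by (simp add: ring_of_type_algebra_simps)
  have base: "B \<subseteq> R.Span (range e) Us"
    using R.Span_base_incl[OF K Us_carr] Us by simp
  have "x \<in> R.Span (range e) Us" if "x \<in> vs.span B" for x
    using that
  proof (induction rule: vs.span_induct_alt)
    case (step c u v)
    show ?case
      using step base add scale by blast
  qed (rule zero)
  hence "R.Span (range e) Us = carrier T_ring"
    using B(3) R.Span_subgroup_props(1)[OF K Us_carr] by (auto simp del: R.Span.simps)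
  hence "R.finite_dimension (range e) (carrier T_ring)"
    using R.Span_finite_dimension[OF K Us_carr] by simp
  thus ?thesis
    using ext by (simp add: finite_field_extension_def)
qed

lemma poly_value_T_ring:
  assumes "x \<in> T"
  shows "poly_value e T_ring p x = poly (map_poly e p) x"
proof -
  interpret R: Ring.field T_ring
    by (rule T_ring_field)
  have fs: "finsum T_ring f A = sum f A" if "\<And>i. i \<in> A \<Longrightarrow> f i \<in> T" "finite A" for f and A :: "nat set"
    using that(2,1)
    by (induction A) (auto simp: R.finsum_insert ring_of_type_algebra_simps Pi_def)
  have "poly_value e T_ring p x = (\<Sum>i\<le>Polynomial.degree p. e (Polynomial.coeff p i) * x ^ i)"
    unfolding poly_value_def T_ring_pow using assms
    by (subst fs) (auto simp: base_mem mult_mem power_mem ring_of_type_algebra_simps)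
  also have "\<dots> = poly (map_poly e p) x"
    using hom_0 by (simp add: poly_altdef coeff_map_poly degree_map_poly)
  finally show ?thesis .
qed

lemma finite_power_reps_T_ring:
  "finite (carrier (power_classes T_ring m)) \<longleftrightarrow> finite_power_reps m T"
proof -
  have [simp]: "carrier (mult_of T_ring) = T - {0}"
    by (simp add: ring_of_type_algebra_simps)
  show ?thesis
    unfolding finite_power_classes_iff[OF T_ring_field] finite_power_reps_def
    by (simp add: T_ring_pow ring_of_type_algebra_simps mult.commute)
qed

text \<open>This is where \<open>type_F'\<close> is turned into finiteness: \<open>T_ring\<close>
  presents \<open>T\<close> as a record, and \<open>type_F'D\<close> admits extensions with elements
  of any type.\<close>

lemma finite_power_reps_if_separable:
  assumes "type_F' TYPE('k) m"
    and "\<And>x. x \<in> T \<Longrightarrow> \<exists>p. Factorial_Ring.irreducible p \<and>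
          Rings.coprime p (Polynomial.pderiv p) \<and> poly (map_poly e p) x = 0"
  shows "finite_power_reps m T"
proof -
  have "finite_separable_extension e T_ring"
    using assms(2) finite_field_extension_T_ring
    by (auto simp: finite_separable_extension_def separable_element_def poly_value_T_ring
        ring_of_type_algebra_simps)
  thus ?thesis
    using type_F'D[OF assms(1)] finite_power_reps_T_ring by blast
qed


text \<open>\<open>vs.dependent\<close> concerns sets, whereas a family of powers may repeat. A
  repetition is itself a relation, with coefficients 1 and -1.\<close>

lemma family_dependent:
  assumes f: "\<And>i. i < n \<Longrightarrow> f i \<in> T" and n: "vs.dim T < n"
  obtains c where "\<exists>i<n. c i \<noteq> 0" "(\<Sum>i<n. e (c i) * f i) = 0"
proof (cases "inj_on f {..<n}")
  case True
  hence "card (f ` {..<n}) = n"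
    by (simp add: card_image)
  hence "vs.dependent (f ` {..<n})"
    using card_le_dim[of "f ` {..<n}"] f n by force
  then obtain u where u: "\<exists>v\<in>f ` {..<n}. u v \<noteq> 0" "(\<Sum>v\<in>f ` {..<n}. e (u v) * v) = 0"
    using vs.dependent_finite[of "f ` {..<n}"] by auto
  show ?thesis
    using u by (intro that[of "\<lambda>i. u (f i)"]) (auto simp: sum.reindex[OF True])
next
  case False
  then obtain i j where ij: "i < n" "j < n" "i \<noteq> j" "f i = f j"
    by (auto simp: inj_on_def)
  let ?c = "\<lambda>k. if k = i then 1 else if k = j then - 1 else 0"
  have "(\<Sum>k<n. e (?c k) * f k) = (\<Sum>k\<in>{i, j}. e (?c k) * f k)"
    using ij by (intro sum.mono_neutral_right) auto
  also have "\<dots> = 0"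
    using ij by (simp add: hom_minus)
  finally show ?thesis
    using ij by (intro that[of ?c]) auto
qed

lemma poly_map_poly_eq_sum:
  "Polynomial.degree p < n \<Longrightarrow> poly (map_poly e p) x = (\<Sum>i<n. e (Polynomial.coeff p i) * x ^ i)"
proof -
  assume n: "Polynomial.degree p < n"
  have "poly (map_poly e p) x = (\<Sum>i\<le>Polynomial.degree p. e (Polynomial.coeff p i) * x ^ i)"
    by (simp add: poly_altdef coeff_map_poly degree_map_poly)
  also have "\<dots> = (\<Sum>i<n. e (Polynomial.coeff p i) * x ^ i)"
    using n by (intro sum.mono_neutral_left) (auto simp: coeff_eq_0)
  finally show ?thesis .
qed

lemma map_poly_mult: "map_poly e (p * q) = map_poly e p * map_poly e q"
  by (intro poly_eqI) (simp add: coeff_map_poly coeff_mult hom_sum hom_mult)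

text \<open>In a factorization of an annihilating polynomial of least degree one factor annihilates
  \<open>x\<close>, so the other is constant. Minimality of the degree is part of the conclusion
  because the independence of the lower powers of \<open>x\<close> is derived from it.\<close>

lemma exists_minimal_poly:
  assumes x: "x \<in> T"
  obtains p where "Factorial_Ring.irreducible p" "poly (map_poly e p) x = 0"
    "\<And>q. q \<noteq> 0 \<Longrightarrow> poly (map_poly e q) x = 0 \<Longrightarrow> Polynomial.degree p \<le> Polynomial.degree q"
proof -
  let ?P = "\<lambda>p. p \<noteq> 0 \<and> poly (map_poly e p) x = 0"
  define n where "n = Suc (vs.dim T)"
  obtain c where c: "\<exists>i<n. c i \<noteq> 0" "(\<Sum>i<n. e (c i) * x ^ i) = 0"
    using family_dependent[of n "\<lambda>i. x ^ i"] power_mem[OF x] unfolding n_def by blast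
  define p0 where "p0 = (\<Sum>i<n. Polynomial.monom (c i) i)"
  have coeff: "Polynomial.coeff p0 i = (if i < n then c i else 0)" for i
    by (simp add: p0_def coeff_sum sum.delta if_distrib cong: if_cong)
  have "Polynomial.degree p0 < n"
    by (rule degree_lessI) (auto simp: coeff n_def)
  hence "?P p0"
    using c poly_map_poly_eq_sum[of p0 n x] by (auto simp: coeff poly_eq_iff)
  then obtain p where p: "?P p" "\<And>q. ?P q \<Longrightarrow> Polynomial.degree p \<le> Polynomial.degree q"
    using ex_has_least_nat[of ?P p0 Polynomial.degree] by blast
  have "\<not> is_unit p"
  proof
    assume "is_unit p"
    hence "Polynomial.degree p = 0"
      using p(1) by (simp add: is_unit_iff_degree)
    then obtain a where "p = [:a:]"
      by (elim degree_eq_zeroE)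
    thus False
      using p(1) by (simp add: map_poly_pCons)
  qed
  moreover have "is_unit a \<or> is_unit b" if ab: "p = a * b" for a b
  proof -
    have ne: "a \<noteq> 0" "b \<noteq> 0"
      using p(1) ab by auto
    have deg: "Polynomial.degree p = Polynomial.degree a + Polynomial.degree b"
      using ab ne by (simp add: degree_mult_eq)
    have "poly (map_poly e a) x = 0 \<or> poly (map_poly e b) x = 0"
      using p(1) by (simp add: ab map_poly_mult)
    hence "Polynomial.degree a = 0 \<or> Polynomial.degree b = 0"
      using p(2)[of a] p(2)[of b] ne deg by auto
    thus ?thesis
      using ne by (auto simp: is_unit_iff_degree)
  qed
  ultimately have "Factorial_Ring.irreducible p"
    using p(1) by (auto intro!: Factorial_Ring.irreducibleI)
  thus ?thesis
    using p by (intro that[of p]) auto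
qed

section \<open>Frobenius and separability\<close>

lemma frobenius:
  assumes "CHAR('k) > 0"
  shows "(x + y :: 'c) ^ CHAR('k) = x ^ CHAR('k) + y ^ CHAR('k)"
proof -
  have "CHAR('c) = CHAR('k)"
  proof (rule CHAR_eqI)
    show "of_nat CHAR('k) = (0 :: 'c)"
      by (metis hom_of_nat hom_0 of_nat_CHAR)
    show "CHAR('k) dvd n" if "of_nat n = (0 :: 'c)" for n
      using that by (metis hom_of_nat hom_eq_0_iff of_nat_eq_0_iff_char_dvd)
  qed
  thus ?thesis
    using assms prime_CHAR_semidom[where ?'a = 'c] freshmans_dream[where ?'a = 'c] by metis
qed

text \<open>This is the compositum of the base field with the field of \<open>p\<close>-th powers of
  \<open>T\<close>.\<close>

abbreviation frobenius_span :: "'c set" where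
  "frobenius_span \<equiv> vs.span ((\<lambda>y. y ^ CHAR('k)) ` T)"

lemma frobenius_span_subset: "frobenius_span \<subseteq> T"
  by (intro vs.span_minimal subspace_T) (auto simp: power_mem)

lemma frobenius_span_subextension:
  assumes char: "CHAR('k) > 0"
  shows "finite_subextension e frobenius_span"
proof
  let ?p = "CHAR('k)" and ?F = "(\<lambda>y. y ^ CHAR('k)) ` T"
  show mult: "x * y \<in> frobenius_span" if "x \<in> frobenius_span" "y \<in> frobenius_span" for x y
    using that(1)
  proof (induction rule: vs.span_induct_alt)
    case (step c u z)
    have "u * y \<in> frobenius_span"
      using that(2)
    proof (induction rule: vs.span_induct_alt)
      case (step d v w)
      have "u * v \<in> ?F"
        using \<open>u \<in> ?F\<close> step(1) by (auto simp: mult_mem simp flip: power_mult_distrib)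
      hence "e d * (u * v) + u * w \<in> frobenius_span"
        using vs.span_add[OF vs.span_scale[OF vs.span_base] step(2)] by blast
      thus ?case
        by (simp add: algebra_simps)
    qed (simp add: vs.span_zero)
    hence "e c * (u * y) + z * y \<in> frobenius_span"
      using step(2) by (intro vs.span_add vs.span_scale)
    thus ?case
      by (simp add: algebra_simps)
  qed (simp add: vs.span_zero)
  have one: "1 \<in> frobenius_span"
    using one_mem by (intro vs.span_base) (auto intro!: image_eqI[of _ _ 1])
  thus "e a \<in> frobenius_span" for a
    using vs.span_scale[OF one, of a] by simp
  show "x + y \<in> frobenius_span" if "x \<in> frobenius_span" "y \<in> frobenius_span" for x y
    using that by (rule vs.span_add)
  have pow: "x ^ n \<in> frobenius_span" if "x \<in> frobenius_span" for x n
    using that by (induction n) (auto simp: one mult)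
  show "inverse x \<in> frobenius_span" if x: "x \<in> frobenius_span" for x
  proof (cases "x = 0")
    case False
    have "inverse x \<in> T"
      using x frobenius_span_subset inverse_mem by blast
    hence "inverse x ^ ?p \<in> frobenius_span"
      by (intro vs.span_base) auto
    \<comment> \<open>The inverse of \<open>x\<close> is known only to lie in \<open>T\<close>, but
      its \<open>p\<close>-th power lies in the span, and multiplying by \<open>x ^ (?p - 1)\<close>
      brings it back to \<open>inverse x\<close>.\<close>
    hence "x ^ (?p - 1) * inverse x ^ ?p \<in> frobenius_span"
      using mult pow x by blast
    also have "x ^ (?p - 1) * inverse x ^ ?p = inverse x"
      using char False by (cases ?p) (simp_all flip: power_mult_distrib mult.assoc)
    finally show ?thesis .
  qed (simp add: vs.span_zero)
  show "\<exists>B. finite B \<and> B \<subseteq> frobenius_span \<and> frobenius_span \<subseteq> vs.span B"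
  proof -
    obtain B where B: "B \<subseteq> frobenius_span" "vs.independent B" "frobenius_span \<subseteq> vs.span B"
      using vs.basis_exists by metis
    thus ?thesis
      using card_le_dim[OF B(2)] frobenius_span_subset by blast
  qed
qed

text \<open>
  If the \<open>p\<close>-th powers span \<open>T\<close>, then Frobenius maps bases to bases and hence preserves linear
  independence. For an inseparable minimal polynomial \<open>f = g(X\<^sup>p)\<close> of \<open>x\<close>, the powers
  \<open>1, x, \<dots>, x\<^bsup>deg g\<^esup>\<close> are independent but their \<open>p\<close>-th powers are not.
\<close>
lemma separable_if_frobenius_span_eq:
  assumes x: "x \<in> T" and span: "CHAR('k) > 0 \<Longrightarrow> frobenius_span = T"
  shows "\<exists>p. Factorial_Ring.irreducible p \<and> Rings.coprime p (Polynomial.pderiv p) \<and>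
           poly (map_poly e p) x = 0"
proof -
  let ?p = "CHAR('k)"
  obtain f where f: "Factorial_Ring.irreducible f" "poly (map_poly e f) x = 0"
    "\<And>q. q \<noteq> 0 \<Longrightarrow> poly (map_poly e q) x = 0 \<Longrightarrow> Polynomial.degree f \<le> Polynomial.degree q"
    using exists_minimal_poly[OF x] by metis
  have "Rings.coprime f (Polynomial.pderiv f)"
  proof (rule ccontr)
    assume ncop: "\<not> Rings.coprime f (Polynomial.pderiv f)"
    have f0: "f \<noteq> 0" and degf: "Polynomial.degree f > 0"
      using f(1) by (auto simp: Factorial_Ring.irreducible_def is_unit_iff_degree)
    have "f dvd Polynomial.pderiv f"
      using ncop f(1) by (metis Factorial_Ring.irreducibleD' coprimeI dvd_trans)
    moreover have "Polynomial.degree (Polynomial.pderiv f) < Polynomial.degree f"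
      using degf by (intro degree_lessI) (auto simp: coeff_pderiv coeff_eq_0)
    ultimately have "Polynomial.pderiv f = 0"
      by (metis dvd_imp_degree_le not_less)
    hence coeff: "Polynomial.coeff f i = 0" if "\<not> ?p dvd i" for i
    proof (cases i)
      case (Suc j)
      have "of_nat i * Polynomial.coeff f i = Polynomial.coeff (Polynomial.pderiv f) j"
        by (simp add: coeff_pderiv Suc)
      thus ?thesis
        using that \<open>Polynomial.pderiv f = 0\<close> of_nat_eq_0_iff_char_dvd[where ?'a = 'k, of i] by simp
    qed (use that in simp)
    \<comment> \<open>In characteristic 0 this says that the degree is 0, against
      \<open>degf\<close>. Both characteristics are thus treated together, and \<open>?p > 0\<close>
      follows.\<close>
    have "?p dvd Polynomial.degree f"
      using coeff[of "Polynomial.degree f"] f0 by auto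
    then obtain r where r: "Polynomial.degree f = ?p * r"
      by auto
    have char: "?p > 0" and r0: "r > 0"
      using r degf by auto
    have p2: "?p \<ge> 2"
      using prime_CHAR_semidom[OF char] prime_ge_2_nat by blast
    let ?d = "Polynomial.degree f"
    have rd: "r < ?d"
      using p2 r0 r by (metis One_nat_def Suc_1 Suc_le_lessD n_less_m_mult_n)
    have indep: "c i = 0" if c: "(\<Sum>i<?d. e (c i) * x ^ i) = 0" "i < ?d" for c i
    proof (rule ccontr)
      assume "c i \<noteq> 0"
      define q where "q = (\<Sum>i<?d. Polynomial.monom (c i) i)"
      have cq: "Polynomial.coeff q i = (if i < ?d then c i else 0)" for i
        by (simp add: q_def coeff_sum sum.delta if_distrib cong: if_cong)
      have "Polynomial.degree q < ?d"
        using degf by (intro degree_lessI) (auto simp: cq)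
      moreover have "q \<noteq> 0"
        using \<open>c i \<noteq> 0\<close> c(2) cq[of i] by auto
      moreover have "poly (map_poly e q) x = 0"
        using c(1) poly_map_poly_eq_sum[OF \<open>Polynomial.degree q < ?d\<close>] by (simp add: cq)
      ultimately show False
        using f(3)[of q] by simp
    qed
    have inj: "inj_on (\<lambda>i. x ^ i) {..<?d}"
    proof (rule inj_onI)
      fix i j assume ij: "i \<in> {..<?d}" "j \<in> {..<?d}" "x ^ i = x ^ j"
      show "i = j"
      proof (rule ccontr)
        assume "i \<noteq> j"
        let ?c = "\<lambda>k. if k = i then 1 else if k = j then - 1 else 0"
        have "(\<Sum>k<?d. e (?c k) * x ^ k) = (\<Sum>k\<in>{i, j}. e (?c k) * x ^ k)"
          using ij by (intro sum.mono_neutral_right) auto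
        also have "\<dots> = 0"
          using ij \<open>i \<noteq> j\<close> by (simp add: hom_minus)
        finally show False
          using indep[of ?c i] ij by simp
      qed
    qed
    have "vs.independent ((\<lambda>i. x ^ i) ` {..<?d})"
    proof (rule vs.independent_if_scalars_zero)
      fix u v assume "(\<Sum>v\<in>(\<lambda>i. x ^ i) ` {..<?d}. e (u v) * v) = 0" "v \<in> (\<lambda>i. x ^ i) ` {..<?d}"
      thus "u v = 0"
        using indep[of "\<lambda>i. u (x ^ i)"] by (auto simp: sum.reindex[OF inj])
    qed auto
    moreover have "(\<lambda>i. x ^ i) ` {..<?d} \<subseteq> T"
      using power_mem[OF x] by auto
    ultimately obtain B where B: "(\<lambda>i. x ^ i) ` {..<?d} \<subseteq> B" "B \<subseteq> T" "vs.independent B"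
        "T \<subseteq> vs.span B"
      using vs.maximal_independent_subset_extend by metis
    have finB: "finite B" and cardB: "card B = vs.dim T"
      using card_le_dim[OF B(3,2)] vs.basis_card_eq_dim[OF B(2,4,3)] by auto
    let ?F = "(\<lambda>y. y ^ ?p) ` B"
    have "y ^ ?p \<in> vs.span ?F" if "y \<in> vs.span B" for y
      using that
    proof (induction rule: vs.span_induct_alt)
      case (step c u z)
      have "e (c ^ ?p) * u ^ ?p + z ^ ?p \<in> vs.span ?F"
        using step by (intro vs.span_add vs.span_scale) (auto intro: vs.span_base)
      thus ?case
        by (simp add: frobenius[OF char] power_mult_distrib hom_power)
    qed (use char in \<open>simp add: power_0_left vs.span_zero\<close>)
    hence "frobenius_span \<subseteq> vs.span ?F"
      using B(4) by (intro vs.span_minimal vs.subspace_span) auto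
    hence T_span: "T \<subseteq> vs.span ?F"
      using span[OF char] by simp
    have "vs.dim T \<le> card ?F"
      using vs.dim_le_card[OF T_span] finB by simp
    hence cardF: "card ?F = card B"
      using cardB card_image_le[OF finB, of "\<lambda>y. y ^ ?p"] by simp
    hence injF: "inj_on (\<lambda>y. y ^ ?p) B"
      using finB by (simp add: eq_card_imp_inj_on)
    have indF: "vs.independent ?F"
    proof
      assume "vs.dependent ?F"
      then obtain v where v: "v \<in> ?F" "v \<in> vs.span (?F - {v})"
        by (auto simp: vs.dependent_def)
      hence "vs.span (?F - {v}) = vs.span ?F"
        using vs.span_redundant[OF v(2)] by (simp add: insert_absorb)
      hence "vs.dim T \<le> card (?F - {v})"
        using T_span finB by (intro vs.dim_le_card) auto
      also have "\<dots> < card ?F"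
        using finB v(1) by (intro psubset_card_mono) auto
      finally show False
        using cardF cardB by simp
    qed
    let ?y = "\<lambda>i. (x ^ i) ^ ?p"
    have sub: "{..r} \<subseteq> {..<?d}"
      using rd by auto
    have injy: "inj_on ?y {..r}"
    proof (rule inj_onI)
      fix i j assume ij: "i \<in> {..r}" "j \<in> {..r}" "?y i = ?y j"
      have "x ^ i \<in> B" "x ^ j \<in> B"
        using B(1) sub ij by blast+
      thus "i = j"
        using inj_onD[OF injF ij(3)] inj_onD[OF inj] sub ij by blast
    qed
    have indy: "vs.independent (?y ` {..r})"
      using B(1) sub by (intro vs.independent_mono[OF indF]) blast
    \<comment> \<open>Only exponents divisible by \<open>?p\<close> survive, so
      \<open>f(x) = 0\<close> becomes a relation between \<open>p\<close>-th powers of the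
      independent elements \<open>x ^ i\<close> with \<open>i \<le> r\<close>; its last coefficient
      is the leading one of \<open>f\<close>.\<close>
    have "0 = (\<Sum>i\<le>?d. e (Polynomial.coeff f i) * x ^ i)"
      using f(2) poly_map_poly_eq_sum[of f "Suc ?d" x] by (simp add: lessThan_Suc_atMost)
    also have "\<dots> = (\<Sum>i\<in>(\<lambda>i. ?p * i) ` {..r}. e (Polynomial.coeff f i) * x ^ i)"
    proof (intro sum.mono_neutral_right ballI)
      fix i assume i: "i \<in> {..?d} - (\<lambda>i. ?p * i) ` {..r}"
      have "\<not> ?p dvd i"
        using i char by (auto simp: r)
      thus "e (Polynomial.coeff f i) * x ^ i = 0"
        using coeff by simp
    qed (auto simp: r)
    also have "\<dots> = (\<Sum>i\<le>r. e (Polynomial.coeff f (?p * i)) * ?y i)"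
      using char by (subst sum.reindex) (auto simp: inj_on_def power_mult mult.commute[of ?p] o_def)
    also have "\<dots> = (\<Sum>v\<in>?y ` {..r}. e (Polynomial.coeff f (?p * inv_into {..r} ?y v)) * v)"
      by (subst sum.reindex[OF injy]) (auto intro!: sum.cong simp: inv_into_f_f[OF injy])
    finally have "Polynomial.coeff f (?p * inv_into {..r} ?y (?y r)) = 0"
      using vs.independentD[OF indy, of "?y ` {..r}"
          "\<lambda>v. Polynomial.coeff f (?p * inv_into {..r} ?y v)" "?y r"] by auto
    hence "Polynomial.coeff f ?d = 0"
      using inv_into_f_f[OF injy, of r] r by simp
    thus False
      using f0 by simp
  qed
  thus ?thesis
    using f by blast
qed

end

lemma (in finite_subextension) dim_less:
  assumes U: "finite_subextension e U" and sub: "U \<subset> T"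
  shows "vs.dim U < vs.dim T"
proof -
  interpret U: finite_subextension e U
    by fact
  obtain B where B: "finite B" "B \<subseteq> U" "vs.independent B" "vs.span B = U" "card B = vs.dim U"
    using U.finite_basis by metis
  obtain t where t: "t \<in> T" "t \<notin> U"
    using sub by auto
  hence "vs.independent (insert t B)"
    using B by (intro vs.independent_insertI) auto
  hence "card (insert t B) \<le> vs.dim T"
    using card_le_dim[of "insert t B"] t B sub by auto
  moreover have "t \<notin> B"
    using t B by auto
  ultimately show ?thesis
    using B by simp
qed

text \<open>With \<open>p u = m w + 1\<close>, the product of \<open>x\<close> and the
  \<open>m\<close>-th power of \<open>x ^ w\<close> is the \<open>u\<close>-th power of
  \<open>x ^ p\<close>. The latter is \<open>r\<close> times an \<open>m\<close>-th power inside the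
  span, so the elements \<open>r ^ u\<close> represent all classes of \<open>T\<close>.\<close>

lemma (in finite_subextension) finite_power_reps_if_frobenius_span:
  assumes U: "finite_power_reps m frobenius_span" and char: "CHAR('k) > 0"
    and m: "prime_to_char TYPE('k) m"
  shows "finite_power_reps m T"
proof -
  let ?p = "CHAR('k)"
  obtain R where R: "finite R" "R \<subseteq> frobenius_span - {0}"
      "\<forall>x\<in>frobenius_span - {0}. \<exists>r\<in>R. \<exists>y\<in>frobenius_span - {0}. x = r * y ^ m"
    using U unfolding finite_power_reps_def by (elim exE conjE) (rule that)
  have "gcd ?p m = 1"
    using m char by (simp add: prime_to_char_def coprime_iff_gcd_eq_1 gcd.commute)
  then obtain u w where uw: "?p * u = m * w + 1"
    using bezout_nat[of ?p m] char by (metis less_not_refl)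
  have pow_pow: "(a ^ i) ^ j = a ^ (j * i)" for a :: 'c and i j
    by (subst mult.commute) (rule power_mult[symmetric])
  have RT: "r \<in> T" "r \<noteq> 0" if "r \<in> R" for r
    using that R(2) frobenius_span_subset by auto
  have "\<exists>r\<in>(\<lambda>r. r ^ u) ` R. \<exists>y\<in>T - {0}. x = r * y ^ m" if x: "x \<in> T - {0}" for x
  proof -
    have "x ^ ?p \<in> frobenius_span - {0}"
      using x vs.span_base[OF imageI[of x T "\<lambda>y. y ^ ?p"]] by simp
    then obtain r y where ry: "r \<in> R" "y \<in> frobenius_span - {0}" "x ^ ?p = r * y ^ m"
      using R(3) by meson
    have y: "y \<in> T" "y \<noteq> 0"
      using ry(2) frobenius_span_subset by auto
    have "x * (x ^ w) ^ m = x ^ (?p * u)"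
      by (simp only: uw pow_pow power_add power_one_right mult.commute[of "x ^ (m * w)"])
    also have "\<dots> = (r * y ^ m) ^ u"
      by (simp only: power_mult ry(3))
    also have "\<dots> = r ^ u * (y ^ u) ^ m"
      by (simp only: power_mult_distrib pow_pow mult.commute[of u])
    finally have eq: "x * (x ^ w) ^ m = r ^ u * (y ^ u) ^ m" .
    have "x = r ^ u * (y ^ u) ^ m / (x ^ w) ^ m"
      using x by (intro eq_divide_imp eq) auto
    hence "x = r ^ u * (y ^ u / x ^ w) ^ m"
      by (simp only: power_divide times_divide_eq_right)
    moreover have "y ^ u / x ^ w \<in> T - {0}"
      using x y by (simp add: divide_mem power_mem)
    ultimately show ?thesis
      using ry(1) by (intro bexI[of _ "r ^ u"] bexI[of _ "y ^ u / x ^ w"]) auto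
  qed
  moreover have "finite ((\<lambda>r. r ^ u) ` R)" "(\<lambda>r. r ^ u) ` R \<subseteq> T - {0}"
    using R(1) RT by (auto simp: power_mem)
  ultimately show ?thesis
    unfolding finite_power_reps_def by (intro exI[of _ "(\<lambda>r. r ^ u) ` R"] conjI ballI)
qed

lemma finite_power_reps_finite_subextension:
  fixes e :: "'k::field \<Rightarrow> 'c::field"
  assumes F: "type_F' TYPE('k) m" and m: "prime_to_char TYPE('k) m"
    and T: "finite_subextension e T"
  shows "finite_power_reps m T"
  using T
proof (induction "vector_space.dim (\<lambda>a x. e a * x) T" arbitrary: T rule: less_induct)
  case less
  interpret finite_subextension e T
    by fact
  show ?case
  \<comment> \<open>The implication puts characteristic 0 into the separable case.\<close>
  proof (cases "CHAR('k) > 0 \<longrightarrow> frobenius_span = T")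
    case True
    thus ?thesis
      using True by (intro finite_power_reps_if_separable[OF F] separable_if_frobenius_span_eq) auto
  next
    case False
    hence char: "CHAR('k) > 0" and ne: "frobenius_span \<noteq> T"
      by blast+
    note U = frobenius_span_subextension[OF char]
    have "frobenius_span \<subset> T"
      using ne frobenius_span_subset by (intro psubsetI)
    hence "finite_power_reps m frobenius_span"
      using U by (intro less.hyps dim_less)
    thus ?thesis
      using char m by (rule finite_power_reps_if_frobenius_span)
  qed
qed

section \<open>Finite extensions of Laurent series fields\<close>

text \<open>These are the properties of a lattice filtration from which everything else is derived
  without coordinates. The level of a product may exceed the sum of the levels, and 1 need not lie
  in \<open>G 0\<close>. In \<open>G_complete\<close> small successive differences amount to the
  Cauchy condition, each \<open>G N\<close> being closed under addition.\<close>

locale filtered_extension = finite_subextension e T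
  for e :: "'a::field fls \<Rightarrow> 'c::field" and T +
  fixes G :: "int \<Rightarrow> 'c set"
  assumes G_subset: "G N \<subseteq> T"
    and G_add: "x \<in> G N \<Longrightarrow> y \<in> G N \<Longrightarrow> x + y \<in> G N"
    and G_mono: "M \<le> N \<Longrightarrow> G N \<subseteq> G M"
    and G_mult: "x \<in> G M \<Longrightarrow> y \<in> G N \<Longrightarrow> x * y \<in> G (M + N)"
    and G_exhaust: "x \<in> T \<Longrightarrow> \<exists>N. x \<in> G N"
    and G_separated: "(\<And>N. x \<in> G N) \<Longrightarrow> x = 0"
    and G_scale: "fls_subdegree f \<ge> 0 \<Longrightarrow> x \<in> G N \<Longrightarrow> e f * x \<in> G N"
    and G_X: "x \<in> G N \<Longrightarrow> e fls_X * x \<in> G (N + 1)"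
    and G_complete: "(\<And>j. u j \<in> T) \<Longrightarrow> (\<And>N. eventually (\<lambda>j. u (Suc j) - u j \<in> G N) sequentially) \<Longrightarrow>
          \<exists>x\<in>T. \<forall>N. eventually (\<lambda>j. u j - x \<in> G N) sequentially"

text \<open>Coefficients are used because \<open>fls_subdegree 0 = 0\<close>, while the zero series
  has to vanish below every bound.\<close>

definition vanishes_below :: "int \<Rightarrow> 'a::zero fls \<Rightarrow> bool" where
  "vanishes_below N f \<longleftrightarrow> (\<forall>n<N. fls_nth f n = 0)"

lemma vanishes_below_mult:
  fixes f g :: "'a::field fls"
  assumes "vanishes_below M f" "vanishes_below N g"
  shows "vanishes_below (M + N) (f * g)"
proof (cases "f = 0 \<or> g = 0")
  case False
  have "M \<le> fls_subdegree f" "N \<le> fls_subdegree g"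
    using assms False by (auto simp: vanishes_below_def intro!: fls_subdegree_geI)
  thus ?thesis
    by (auto simp: vanishes_below_def intro!: fls_times_nth_eq0)
qed (auto simp: vanishes_below_def)

lemma vanishes_below_0_iff: "vanishes_below 0 f \<longleftrightarrow> fls_subdegree f \<ge> 0"
proof
  assume "vanishes_below 0 f"
  thus "fls_subdegree f \<ge> 0"
    by (cases "f = 0") (auto simp: vanishes_below_def intro!: fls_subdegree_geI)
qed (auto simp: vanishes_below_def intro!: fls_eq0_below_subdegree)

text \<open>From stage \<open>J N\<close> on, coefficients below \<open>N\<close> no longer change.
  The limit therefore takes its coefficient \<open>n\<close> from stage
  \<open>J (n + 1)\<close>.\<close>

lemma fls_complete:
  fixes u :: "nat \<Rightarrow> 'a::field fls"
  assumes "\<And>N. eventually (\<lambda>j. vanishes_below N (u (Suc j) - u j)) sequentially"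
  shows "\<exists>f. \<forall>N. eventually (\<lambda>j. vanishes_below N (u j - f)) sequentially"
proof -
  have "\<forall>N. \<exists>J. \<forall>j\<ge>J. vanishes_below N (u (Suc j) - u j)"
    using assms by (simp add: eventually_sequentially)
  then obtain J where J: "\<And>N j. j \<ge> J N \<Longrightarrow> vanishes_below N (u (Suc j) - u j)"
    by metis
  have const: "fls_nth (u j) n = fls_nth (u (J N)) n" if "j \<ge> J N" "n < N" for j n N
    using that(1)
  proof (induction j rule: dec_induct)
    case (step j)
    thus ?case
      using J[of N j] that(2) by (simp add: vanishes_below_def)
  qed simp
  have const': "fls_nth (u (J M)) n = fls_nth (u (J N)) n" if "n < M" "n < N" for M N n
    using const[of M "max (J M) (J N)" n] const[of N "max (J M) (J N)" n] that by simp
  define f where "f = Abs_fls (\<lambda>n. fls_nth (u (J (n + 1))) n)"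
  have nth: "fls_nth f n = fls_nth (u (J (n + 1))) n" for n
    unfolding f_def
  \<comment> \<open>All negative coefficients agree with those of the single series
    \<open>u (J 0)\<close>, so only finitely many are nonzero.\<close>
  proof (rule nth_Abs_fls_ex_lower_bound)
    obtain M where M: "\<And>n. n < M \<Longrightarrow> fls_nth (u (J 0)) n = 0"
      using fls_nth_vanishes_belowE[of "u (J 0)"] by blast
    have "fls_nth (u (J (n + 1))) n = 0" if "n < min M 0" for n
      using const'[of n "n + 1" 0] that M by simp
    thus "\<exists>N. \<forall>n<N. fls_nth (u (J (n + 1))) n = 0"
      by blast
  qed
  have "vanishes_below N (u j - f)" if "j \<ge> J N" for N j
  proof -
    have "fls_nth (u j) n = fls_nth f n" if "n < N" for n
      using const[OF \<open>j \<ge> J N\<close> that] const'[of n "n + 1" N] that nth[of n] by simp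
    thus ?thesis
      by (simp add: vanishes_below_def)
  qed
  thus ?thesis
    by (auto simp: eventually_sequentially)
qed

text \<open>
  The filtration is given by the multiples \<open>t\<^sup>N \<Lambda>\<close> of a lattice \<open>\<Lambda>\<close>. Shifting the index by a
  constant that bounds the denominators of \<open>\<Lambda>\<Lambda>\<close> makes it multiplicative.
\<close>
lemma exists_filtration:
  fixes e :: "'a::field fls \<Rightarrow> 'c::field"
  assumes "finite_subextension e T"
  shows "\<exists>G. filtered_extension e T G"
proof -
  interpret finite_subextension e T
    by fact
  obtain B where B: "finite B" "B \<subseteq> T" "vs.independent B" "vs.span B = T"
    using finite_basis by metis
  define r where "r = vs.representation B"
  have r_add: "r (x + y) b = r x b + r y b" if "x \<in> T" "y \<in> T" for x y b
    using that B by (simp add: r_def vs.representation_add)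
  have r_scale: "r (e f * x) b = f * r x b" if "x \<in> T" for x f b
    using that B by (simp add: r_def vs.representation_scale)
  have r_sum: "(\<Sum>b\<in>B. e (r x b) * b) = x" if "x \<in> T" for x
    using that B unfolding r_def by (intro vs.sum_representation_eq) auto
  have r_diff: "r (x - y) b = r x b - r y b" if "x \<in> T" "y \<in> T" for x y b
    using that B by (simp add: r_def vs.representation_diff)
  have r_comb: "r (\<Sum>b\<in>B. e (g b) * b) b = g b" if "b \<in> B" for g b
  proof -
    have "r (\<Sum>b\<in>B. e (g b) * b) b = (\<Sum>b'\<in>B. r (e (g b') * b') b)"
      unfolding r_def using B
      by (subst vs.representation_sum) (auto intro: vs.span_scale vs.span_base)
    also have "\<dots> = (\<Sum>b'\<in>B. if b' = b then g b else 0)"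
    proof (intro sum.cong refl)
      fix b' assume b': "b' \<in> B"
      hence "r (e (g b') * b') b = g b' * r b' b"
        using B(2) r_scale by auto
      thus "r (e (g b') * b') b = (if b' = b then g b else 0)"
        using vs.representation_basis[OF B(3) b'] by (simp add: r_def)
    qed
    finally show ?thesis
      using that B(1) by simp
  qed
  \<comment> \<open>This is \<open>t^N\<close> times the \<open>K[[t]]\<close>-lattice spanned by
    the basis \<open>B\<close>.\<close>
  define \<Lambda> where "\<Lambda> N = {x\<in>T. \<forall>b\<in>B. vanishes_below N (r x b)}" for N
  have \<Lambda>_add: "x + y \<in> \<Lambda> N" if "x \<in> \<Lambda> N" "y \<in> \<Lambda> N" for x y N
    using that by (auto simp: \<Lambda>_def r_add add_mem vanishes_below_def)
  have \<Lambda>_zero: "0 \<in> \<Lambda> N" for N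
    by (auto simp: \<Lambda>_def zero_mem r_def vs.representation_zero vanishes_below_def)
  have \<Lambda>_sum: "sum g I \<in> \<Lambda> N" if "\<And>i. i \<in> I \<Longrightarrow> g i \<in> \<Lambda> N" for g :: "'c \<Rightarrow> 'c" and I N
    using that by (induction I rule: infinite_finite_induct) (auto simp: \<Lambda>_add \<Lambda>_zero)
  have \<Lambda>_scale: "e f * x \<in> \<Lambda> (M + N)" if "vanishes_below M f" "x \<in> \<Lambda> N" for f x M N
    using that by (auto simp: \<Lambda>_def mult_mem base_mem r_scale intro!: vanishes_below_mult)
  have \<Lambda>_mono: "\<Lambda> N \<subseteq> \<Lambda> M" if "M \<le> N" for M N
    using that by (auto simp: \<Lambda>_def vanishes_below_def)
  have \<Lambda>_exh: "\<exists>N. x \<in> \<Lambda> N" if "x \<in> T" for x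
  proof -
    have "\<exists>N. vanishes_below N (r x b)" for b
      using fls_nth_vanishes_belowE[of "r x b"] unfolding vanishes_below_def by metis
    then obtain N where N: "\<And>b. vanishes_below (N b) (r x b)"
      by metis
    have "vanishes_below (Min (insert 0 (N ` B))) (r x b)" if "b \<in> B" for b
      using N[of b] that B(1) by (auto simp: vanishes_below_def)
    thus ?thesis
      using that by (auto simp: \<Lambda>_def)
  qed
  \<comment> \<open>The finitely many products of basis elements have a common bound on their
    denominators. Inserting 0 keeps the set under \<open>Min\<close> nonempty.\<close>
  have "\<exists>c. \<forall>z\<in>(\<lambda>(b, b'). b * b') ` (B \<times> B). z \<in> \<Lambda> (- c)"
  proof -
    have "\<exists>N. z \<in> \<Lambda> N" if "z \<in> (\<lambda>(b, b'). b * b') ` (B \<times> B)" for z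
    proof -
      have "z \<in> T"
        using that B(2) mult_mem by (auto simp: subset_iff)
      thus ?thesis
        by (rule \<Lambda>_exh)
    qed
    then obtain N where N: "\<And>z. z \<in> (\<lambda>(b, b'). b * b') ` (B \<times> B) \<Longrightarrow> z \<in> \<Lambda> (N z)"
      by metis
    have "z \<in> \<Lambda> (Min (insert 0 (N ` (\<lambda>(b, b'). b * b') ` (B \<times> B))))"
      if "z \<in> (\<lambda>(b, b'). b * b') ` (B \<times> B)" for z
      by (rule subsetD[OF \<Lambda>_mono N[OF that]]) (use that B(1) in auto)
    thus ?thesis
      by (metis minus_minus)
  qed
  then obtain c where c: "\<And>b b'. b \<in> B \<Longrightarrow> b' \<in> B \<Longrightarrow> b * b' \<in> \<Lambda> (- c)"
    by auto
  have \<Lambda>_mult: "x * y \<in> \<Lambda> (M + N - c)" if xy: "x \<in> \<Lambda> M" "y \<in> \<Lambda> N" for x y M N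
  proof -
    have xyT: "x \<in> T" "y \<in> T"
      using xy by (auto simp: \<Lambda>_def)
    have "x * y = (\<Sum>b\<in>B. \<Sum>b'\<in>B. e (r x b * r y b') * (b * b'))"
      by (subst r_sum[OF xyT(1), symmetric], subst r_sum[OF xyT(2), symmetric])
         (simp add: sum_product hom_mult mult_ac)
    also have "\<dots> \<in> \<Lambda> ((M + N) + (- c))"
      using xy by (intro \<Lambda>_sum \<Lambda>_scale c vanishes_below_mult) (auto simp: \<Lambda>_def)
    finally show ?thesis
      by simp
  qed
  have "filtered_extension e T (\<lambda>N. \<Lambda> (N + c))"
  proof
    show "\<Lambda> (N + c) \<subseteq> T" for N
      by (auto simp: \<Lambda>_def)
    show "x + y \<in> \<Lambda> (N + c)" if "x \<in> \<Lambda> (N + c)" "y \<in> \<Lambda> (N + c)" for x y N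
      using that by (rule \<Lambda>_add)
    show "\<Lambda> (N + c) \<subseteq> \<Lambda> (M + c)" if "M \<le> N" for M N
      using that by (intro \<Lambda>_mono) simp
    show "x * y \<in> \<Lambda> (M + N + c)" if "x \<in> \<Lambda> (M + c)" "y \<in> \<Lambda> (N + c)" for x y M N
      using \<Lambda>_mult[OF that] by (simp add: algebra_simps)
    show "\<exists>N. x \<in> \<Lambda> (N + c)" if "x \<in> T" for x
      using \<Lambda>_exh[OF that] by (metis diff_add_cancel)
    show "x = 0" if x: "\<And>N. x \<in> \<Lambda> (N + c)" for x
    proof -
      have "fls_nth (r x b) n = 0" if "b \<in> B" for b n
        using x[of "n + 1 - c"] that by (auto simp: \<Lambda>_def vanishes_below_def)
      hence "(\<Sum>b\<in>B. e (r x b) * b) = 0"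
        by (intro sum.neutral) (auto simp: fls_zero_eqI)
      thus ?thesis
        using r_sum[of x] x[of 0] by (auto simp: \<Lambda>_def)
    qed
    show "e f * x \<in> \<Lambda> (N + c)" if "fls_subdegree f \<ge> 0" "x \<in> \<Lambda> (N + c)" for f x N
      using \<Lambda>_scale[of 0 f x "N + c"] that by (simp add: vanishes_below_0_iff)
    show "e fls_X * x \<in> \<Lambda> (N + 1 + c)" if "x \<in> \<Lambda> (N + c)" for x N
      using \<Lambda>_scale[of 1 fls_X x "N + c"] that by (simp add: vanishes_below_def algebra_simps)
    show "\<exists>x\<in>T. \<forall>N. eventually (\<lambda>j. u j - x \<in> \<Lambda> (N + c)) sequentially"
      if uT: "\<And>j. u j \<in> T"
        and u: "\<And>N. eventually (\<lambda>j. u (Suc j) - u j \<in> \<Lambda> (N + c)) sequentially" for u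
    proof -
      have "\<exists>f. \<forall>N. eventually (\<lambda>j. vanishes_below N (r (u j) b - f)) sequentially" if "b \<in> B" for b
      proof (rule fls_complete)
        fix N
        show "eventually (\<lambda>j. vanishes_below N (r (u (Suc j)) b - r (u j) b)) sequentially"
          using u[of "N - c"] by eventually_elim (use that uT in \<open>simp add: \<Lambda>_def r_diff\<close>)
      qed
      then obtain f where f: "\<And>b N. b \<in> B \<Longrightarrow>
          eventually (\<lambda>j. vanishes_below N (r (u j) b - f b)) sequentially"
        by metis
      define y where "y = (\<Sum>b\<in>B. e (f b) * b)"
      have y: "y \<in> T"
        unfolding y_def using B(2) by (intro sum_mem) (auto simp: base_mem mult_mem)
      have "eventually (\<lambda>j. u j - y \<in> \<Lambda> (N + c)) sequentially" for N
      proof -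
        have "eventually (\<lambda>j. \<forall>b\<in>B. vanishes_below (N + c) (r (u j) b - f b)) sequentially"
          using f B(1) by (intro eventually_ball_finite) auto
        thus ?thesis
        proof eventually_elim
          case (elim j)
          have "r (u j - y) b = r (u j) b - f b" if "b \<in> B" for b
            using r_diff[OF uT y] r_comb[OF that] by (simp add: y_def)
          thus ?case
            using elim uT y by (simp add: \<Lambda>_def diff_mem)
        qed
      qed
      thus ?thesis
        using y by blast
    qed
  qed
  thus ?thesis
    by blast
qed

section \<open>Power-bounded and topologically nilpotent elements\<close>

context filtered_extension
begin

text \<open>\<open>A\<close> turns out to be the valuation ring of \<open>T\<close>, with maximal ideal \<open>M\<close>.\<close>

definition A :: "'c set" where
  "A = {x\<in>T. \<exists>N. \<forall>k. x ^ k \<in> G N}"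

definition M :: "'c set" where
  "M = {x\<in>T. \<exists>k. x ^ k \<in> G 1}"

text \<open>Any finite part of \<open>A\<close> lies in one such ring, whose elements share a single
  bound. This replaces estimates of the powers of sums and products of power-bounded
  elements.\<close>

definition bounded_subring :: "'c set \<Rightarrow> bool" where
  "bounded_subring B \<longleftrightarrow> (\<forall>f. fls_subdegree f \<ge> 0 \<longrightarrow> e f \<in> B) \<and>
     (\<forall>x\<in>B. \<forall>y\<in>B. x + y \<in> B \<and> x * y \<in> B) \<and> (\<exists>N. B \<subseteq> G N)"

lemma G_zero: "0 \<in> G N"
proof -
  obtain N' where "0 \<in> G N'"
    using G_exhaust[OF zero_mem] by blast
  thus ?thesis
  proof (cases "N \<le> N'")
    case False
    have "0 \<in> G (N' + int k)" for k
    proof (induction k)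
      case (Suc k)
      thus ?case
        using G_X[of 0 "N' + int k"] by (simp add: algebra_simps)
    qed (use \<open>0 \<in> G N'\<close> in simp)
    from this[of "nat (N - N')"] show ?thesis
      using False by simp
  qed (use G_mono in blast)
qed

lemma G_le: "x \<in> G N \<Longrightarrow> N' \<le> N \<Longrightarrow> x \<in> G N'"
  using G_mono by blast

lemma G_minus: "x \<in> G N \<Longrightarrow> - x \<in> G N"
  using G_scale[of "-1" x N] by (simp add: hom_minus)

lemma G_diff: "x \<in> G N \<Longrightarrow> y \<in> G N \<Longrightarrow> x - y \<in> G N"
  using G_add[of x N "- y"] G_minus[of y N] by simp

lemma G_sum: "(\<And>i. i \<in> I \<Longrightarrow> f i \<in> G N) \<Longrightarrow> sum f I \<in> G N"
  by (induction I rule: infinite_finite_induct) (auto simp: G_zero G_add)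

lemma finite_subset_G:
  assumes "finite F" "F \<subseteq> T"
  shows "\<exists>N. F \<subseteq> G N"
  using assms
proof (induction F)
  case (insert x F)
  then obtain M N where "x \<in> G M" "F \<subseteq> G N"
    using G_exhaust by blast
  hence "insert x F \<subseteq> G (min M N)"
    using G_mono[of "min M N" M] G_mono[of "min M N" N] by auto
  thus ?case
    by blast
qed auto

lemma G_power: "x \<in> G 1 \<Longrightarrow> k > 0 \<Longrightarrow> x ^ k \<in> G (int k)"
proof (induction k)
  case (Suc k)
  thus ?case
    using G_mult[of x 1 "x ^ k" "int k"] by (cases k) (auto simp: algebra_simps)
qed auto

lemma bounded_subringD:
  assumes "bounded_subring B"
  shows "fls_subdegree f \<ge> 0 \<Longrightarrow> e f \<in> B"
    and "x \<in> B \<Longrightarrow> y \<in> B \<Longrightarrow> x + y \<in> B"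
    and "x \<in> B \<Longrightarrow> y \<in> B \<Longrightarrow> x * y \<in> B"
    and "\<exists>N. B \<subseteq> G N"
    and "B \<subseteq> T"
  using assms G_subset unfolding bounded_subring_def by blast+

lemma bounded_subring_props:
  assumes B: "bounded_subring B"
  shows "0 \<in> B" "1 \<in> B" "x \<in> B \<Longrightarrow> - x \<in> B" "x \<in> B \<Longrightarrow> y \<in> B \<Longrightarrow> x - y \<in> B"
    "x \<in> B \<Longrightarrow> x ^ n \<in> B" "of_nat n \<in> B"
    "(\<And>i. i \<in> I \<Longrightarrow> f i \<in> B) \<Longrightarrow> sum f I \<in> B"
proof -
  show zero: "0 \<in> B" and one: "1 \<in> B"
    using bounded_subringD(1)[OF B, of 0] bounded_subringD(1)[OF B, of 1] by simp_all
  show minus: "- x \<in> B" if "x \<in> B" for x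
    using bounded_subringD(3)[OF B bounded_subringD(1)[OF B, of "-1"] that] by (simp add: hom_minus)
  show "x - y \<in> B" if "x \<in> B" "y \<in> B" for x y
    using bounded_subringD(2)[OF B that(1) minus[OF that(2)]] by simp
  show "x ^ n \<in> B" if "x \<in> B" for x n
    using that by (induction n) (auto simp: one bounded_subringD(3)[OF B])
  show "of_nat n \<in> B" for n
    by (induction n) (auto simp: zero one bounded_subringD(2)[OF B])
  show "sum f I \<in> B" if "\<And>i. i \<in> I \<Longrightarrow> f i \<in> B" for f and I :: "'z set"
    using that
    by (induction I rule: infinite_finite_induct) (auto simp: zero bounded_subringD(2)[OF B])
qed

lemma poly_mem_bounded_subring:
  assumes "bounded_subring B" "\<And>i. Polynomial.coeff p i \<in> B" "x \<in> B"
  shows "poly p x \<in> B"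
  using assms unfolding poly_altdef
  by (intro bounded_subring_props(7) bounded_subringD(3) bounded_subring_props(5))

lemma bounded_subring_base: "bounded_subring (e ` {f. fls_subdegree f \<ge> 0})"
proof -
  obtain N where "1 \<in> G N"
    using G_exhaust one_mem by blast
  hence "e ` {f. fls_subdegree f \<ge> 0} \<subseteq> G N"
    using G_scale[of _ 1 N] by auto
  moreover have "fls_subdegree (f + g) \<ge> 0" "fls_subdegree (f * g) \<ge> 0"
    if "fls_subdegree f \<ge> 0" "fls_subdegree g \<ge> 0" for f g :: "'a fls"
    using that vanishes_below_mult[of 0 f 0 g] by (auto simp: vanishes_below_def simp flip: vanishes_below_0_iff)
  ultimately show ?thesis
    unfolding bounded_subring_def by (auto simp flip: hom_add hom_mult)
qed

lemma bounded_subring_subset_A: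
  assumes "bounded_subring B"
  shows "B \<subseteq> A"
  using bounded_subring_props(5)[OF assms] bounded_subringD(4,5)[OF assms] unfolding A_def by blast

text \<open>The ring \<open>B[x]\<close> is bounded: coefficients share one bound, powers of
  \<open>x\<close> another, and sums of any length stay at the same level.\<close>

lemma bounded_subring_adjoin:
  assumes B: "bounded_subring B" and x: "x \<in> A"
  shows "\<exists>B'. bounded_subring B' \<and> B \<subseteq> B' \<and> x \<in> B'"
proof -
  let ?P = "{p. \<forall>i. Polynomial.coeff p i \<in> B}"
  obtain N N' where N: "B \<subseteq> G N" and N': "\<And>k. x ^ k \<in> G N'"
    using bounded_subringD(4)[OF B] x by (auto simp: A_def)
  have "poly p x \<in> G (N + N')" if "p \<in> ?P" for p
    using that N N' unfolding poly_altdef by (intro G_sum G_mult) auto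
  moreover have const: "[:b:] \<in> ?P" if "b \<in> B" for b
    using that bounded_subring_props(1)[OF B] by (auto simp: coeff_pCons split: nat.splits)
  hence sub: "B \<subseteq> (\<lambda>p. poly p x) ` ?P"
    by (auto intro!: image_eqI[of _ _ "[:b:]" for b])
  moreover have "p + q \<in> ?P" "p * q \<in> ?P" if "p \<in> ?P" "q \<in> ?P" for p q
    using that by (auto simp: coeff_mult intro!: bounded_subringD(2,3)[OF B] bounded_subring_props(7)[OF B])
  hence "u + v \<in> (\<lambda>p. poly p x) ` ?P \<and> u * v \<in> (\<lambda>p. poly p x) ` ?P"
    if "u \<in> (\<lambda>p. poly p x) ` ?P" "v \<in> (\<lambda>p. poly p x) ` ?P" for u v
    using that by (auto simp flip: poly_add poly_mult intro!: imageI)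
  ultimately have "bounded_subring ((\<lambda>p. poly p x) ` ?P)"
    using bounded_subringD(1)[OF B] unfolding bounded_subring_def by blast
  moreover have "x \<in> (\<lambda>p. poly p x) ` ?P"
    using bounded_subring_props(1,2)[OF B]
    by (intro image_eqI[of _ _ "[:0, 1:]"]) (auto simp: coeff_pCons split: nat.splits)
  ultimately show ?thesis
    using sub by blast
qed

lemma finite_subset_bounded_subring:
  assumes "finite F" "F \<subseteq> A"
  obtains B where "bounded_subring B" "F \<subseteq> B"
proof -
  have "\<exists>B. bounded_subring B \<and> F \<subseteq> B"
    using assms
  proof (induction F)
    case (insert x F)
    then obtain B where "bounded_subring B" "F \<subseteq> B"
      by auto
    thus ?case
      using bounded_subring_adjoin[of B x] insert.prems by blast
  qed (use bounded_subring_base in blast)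
  thus ?thesis
    using that by blast
qed

lemma A_subset: "A \<subseteq> T"
  by (auto simp: A_def)

lemma A_base: "fls_subdegree f \<ge> 0 \<Longrightarrow> e f \<in> A"
  using bounded_subring_subset_A[OF bounded_subring_base] by blast

lemma A_zero: "0 \<in> A" and A_one: "1 \<in> A"
  using A_base[of 0] A_base[of 1] by simp_all

lemma A_add: "x + y \<in> A" and A_mult: "x * y \<in> A" and A_diff: "x - y \<in> A"
  if xy: "x \<in> A" "y \<in> A"
proof -
  obtain B where B: "bounded_subring B" "{x, y} \<subseteq> B"
    by (rule finite_subset_bounded_subring[of "{x, y}"]) (use xy in auto)
  hence "x + y \<in> B" "x * y \<in> B" "x - y \<in> B"
    using bounded_subringD(2,3)[OF B(1)] bounded_subring_props(4)[OF B(1)] by auto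
  thus "x + y \<in> A" "x * y \<in> A" "x - y \<in> A"
    using bounded_subring_subset_A[OF B(1)] by auto
qed

lemma A_minus: "x \<in> A \<Longrightarrow> - x \<in> A"
  using A_diff[OF A_zero] by simp

lemma A_sum: "(\<And>i. i \<in> I \<Longrightarrow> f i \<in> A) \<Longrightarrow> sum f I \<in> A"
  by (induction I rule: infinite_finite_induct) (auto simp: A_zero A_add)

lemma A_power: "x \<in> A \<Longrightarrow> x ^ n \<in> A"
  by (induction n) (auto simp: A_one A_mult)

lemma A_poly: "(\<And>i. Polynomial.coeff p i \<in> A) \<Longrightarrow> x \<in> A \<Longrightarrow> poly p x \<in> A"
  unfolding poly_altdef by (intro A_sum A_mult A_power)

text \<open>The coefficients lie in a bounded ring \<open>B\<close>. Reduction by the monic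
  \<open>p\<close> writes every power of \<open>u\<close> as a \<open>B\<close>-combination of the
  finitely many powers below the degree, which gives a common bound.\<close>

lemma A_integrally_closed:
  assumes u: "u \<in> T" and p: "Polynomial.lead_coeff p = 1" "\<And>i. Polynomial.coeff p i \<in> A"
    and root: "poly p u = 0"
  shows "u \<in> A"
proof -
  let ?d = "Polynomial.degree p"
  obtain B where B: "bounded_subring B" "Polynomial.coeff p ` {..?d} \<subseteq> B"
    using finite_subset_bounded_subring[of "Polynomial.coeff p ` {..?d}"] p(2) by auto
  have coeff: "Polynomial.coeff p i \<in> B" for i
    using B(2) bounded_subring_props(1)[OF B(1)]
    by (cases "i \<le> ?d") (auto simp: coeff_eq_0)
  have d: "?d > 0"
  proof (rule ccontr)
    assume "\<not> ?d > 0"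
    then obtain a where a: "p = [:a:]"
      using degree_eq_zeroE by blast
    thus False
      using p(1) root by simp
  qed
  obtain N where N: "B \<subseteq> G N"
    using bounded_subringD(4)[OF B(1)] by blast
  obtain N' where N': "(\<lambda>i. u ^ i) ` {..<?d} \<subseteq> G N'"
    using finite_subset_G[of "(\<lambda>i. u ^ i) ` {..<?d}"] power_mem[OF u] by blast
  have "\<exists>q. Polynomial.degree q < ?d \<and> (\<forall>i. Polynomial.coeff q i \<in> B) \<and> u ^ k = poly q u" for k
  proof (induction k)
    case 0
    show ?case
      using d bounded_subring_props(1,2)[OF B(1)]
      by (intro exI[of _ 1]) (auto simp: coeff_1)
  next
    case (Suc k)
    then obtain q where q: "Polynomial.degree q < ?d" "\<And>i. Polynomial.coeff q i \<in> B"
        "u ^ k = poly q u"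
      by auto
    \<comment> \<open>The possible term of degree \<open>?d\<close> in \<open>X q\<close> is
      cancelled by a multiple of the monic \<open>p\<close>.\<close>
    let ?q = "pCons 0 q - smult (Polynomial.coeff q (?d - 1)) p"
    have "Polynomial.coeff ?q i = 0" if "i \<ge> ?d" for i
    proof (cases "i = ?d")
      case True
      thus ?thesis
        using p(1) d by (cases ?d) auto
    next
      case False
      thus ?thesis
        using that q(1) by (cases i) (auto simp: coeff_eq_0)
    qed
    hence "Polynomial.degree ?q < ?d"
      using d by (intro degree_lessI) auto
    moreover have "Polynomial.coeff ?q i \<in> B" for i
      using q(2) coeff bounded_subring_props(1,4)[OF B(1)] bounded_subringD(3)[OF B(1)]
      by (auto simp: coeff_pCons split: nat.splits)
    moreover have "u ^ Suc k = poly ?q u"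
      using q(3) root by simp
    ultimately show ?case
      by blast
  qed
  moreover have "poly q u \<in> G (N + N')"
    if "Polynomial.degree q < ?d" "\<And>i. Polynomial.coeff q i \<in> B" for q
    using that N N' unfolding poly_altdef by (intro G_sum G_mult) auto
  ultimately have "u ^ k \<in> G (N + N')" for k
    by metis
  thus ?thesis
    using u by (auto simp: A_def)
qed

lemma one_notin_M: "1 \<notin> M"
proof
  assume "1 \<in> M"
  hence one: "1 \<in> G 1"
    by (auto simp: M_def)
  have "1 \<in> G N" for N
  proof -
    have "1 \<in> G (int (Suc (nat N)))"
      using G_power[OF one, of "Suc (nat N)"] by simp
    thus ?thesis
      by (rule G_le) simp
  qed
  from G_separated[OF this] show False
    by simp
qed

lemma G1_subset_M: "G 1 \<subseteq> M"
  using G_subset by (auto simp: M_def intro!: exI[of _ 1])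

lemma M_radical: "x ^ k \<in> M \<Longrightarrow> x \<in> T \<Longrightarrow> x \<in> M"
  by (auto simp: M_def simp flip: power_mult)

text \<open>Exponents are divided by \<open>k\<close> with remainder: powers of \<open>x ^ k\<close>
  only rise in the filtration, and there are finitely many remainders.\<close>

lemma M_subset_A: "M \<subseteq> A"
proof
  fix x assume "x \<in> M"
  then obtain k where x: "x \<in> T" and k: "x ^ k \<in> G 1"
    by (auto simp: M_def)
  have k0: "k > 0"
    using k one_notin_M G1_subset_M by (cases k) auto
  obtain N where N: "(\<lambda>i. x ^ i) ` {..<k} \<subseteq> G N"
    using finite_subset_G[of "(\<lambda>i. x ^ i) ` {..<k}"] power_mem[OF x] by blast
  have "x ^ n \<in> G (min N (N + 0))" for n
  proof (cases "n div k > 0")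
    case True
    have "x ^ n = (x ^ k) ^ (n div k) * x ^ (n mod k)"
      by (simp flip: power_mult power_add)
    also have "\<dots> \<in> G (int (n div k) + N)"
      using N k0 G_power[OF k True] by (intro G_mult) auto
    finally show ?thesis
      using G_mono[of N "int (n div k) + N"] by auto
  next
    case False
    hence "n < k"
      using k0 by (simp add: div_greater_zero_iff)
    thus ?thesis
      using N by auto
  qed
  thus "x \<in> A"
    using x by (auto simp: A_def)
qed

text \<open>The uniformity in \<open>b\<close> is the point: it gives the ideal properties of
  \<open>M\<close> and the convergence of the iteration in Hensel's lemma.\<close>

lemma M_power_absorbs:
  assumes B: "bounded_subring B" and x: "x \<in> B" "x \<in> M"
  shows "\<exists>k0. \<forall>k\<ge>k0. \<forall>b\<in>B. x ^ k * b \<in> G N"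
proof -
  obtain k where k: "x ^ k \<in> G 1"
    using x by (auto simp: M_def)
  obtain N' where N': "B \<subseteq> G N'"
    using bounded_subringD(4)[OF B] by blast
  \<comment> \<open>Chosen so that \<open>int j + N' \<ge> N\<close>; \<open>Suc\<close> provides
    the positive exponent required by \<open>G_power\<close>.\<close>
  define j where "j = Suc (nat (N - N'))"
  have "x ^ n * b \<in> G N" if n: "n \<ge> k * j" and b: "b \<in> B" for n b
  proof -
    have "x ^ (n - k * j) * b \<in> G N'"
      using x b N' bounded_subringD(3)[OF B] bounded_subring_props(5)[OF B] by blast
    moreover have "(x ^ k) ^ j \<in> G (int j)"
      using k by (intro G_power) (auto simp: j_def)
    ultimately have "(x ^ k) ^ j * (x ^ (n - k * j) * b) \<in> G (int j + N')"
      by (intro G_mult)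
    also have "(x ^ k) ^ j * (x ^ (n - k * j) * b) = x ^ n * b"
      using n by (simp flip: power_mult power_add mult.assoc)
    finally show ?thesis
      by (rule G_le) (simp add: j_def)
  qed
  thus ?thesis
    by blast
qed

lemma M_absorb: "x * y \<in> M" if x: "x \<in> M" and y: "y \<in> A"
proof -
  obtain B where B: "bounded_subring B" "{x, y} \<subseteq> B"
    by (rule finite_subset_bounded_subring[of "{x, y}"]) (use x y M_subset_A in auto)
  obtain k where "\<forall>b\<in>B. x ^ k * b \<in> G 1"
    using M_power_absorbs[OF B(1), of x 1] B(2) x by auto
  hence "(x * y) ^ k \<in> G 1"
    using B bounded_subring_props(5)[OF B(1)] by (auto simp: power_mult_distrib)
  thus ?thesis
    using x y by (auto simp: M_def A_def mult_mem)
qed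

text \<open>In each binomial term of exponent \<open>k1 + k2\<close>, either \<open>x\<close> has
  exponent at least \<open>k1\<close> or \<open>y\<close> has exponent at least \<open>k2\<close>,
  and the remaining factors stay in \<open>B\<close>.\<close>

lemma M_add: "x + y \<in> M" if x: "x \<in> M" and y: "y \<in> M"
proof -
  obtain B where B: "bounded_subring B" "{x, y} \<subseteq> B"
    by (rule finite_subset_bounded_subring[of "{x, y}"]) (use x y M_subset_A in auto)
  obtain k1 where k1: "\<And>k b. k \<ge> k1 \<Longrightarrow> b \<in> B \<Longrightarrow> x ^ k * b \<in> G 1"
    using M_power_absorbs[OF B(1) _ x, of 1] B(2) by auto
  obtain k2 where k2: "\<And>k b. k \<ge> k2 \<Longrightarrow> b \<in> B \<Longrightarrow> y ^ k * b \<in> G 1"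
    using M_power_absorbs[OF B(1) _ y, of 1] B(2) by auto
  have "of_nat ((k1 + k2) choose i) * x ^ i * y ^ (k1 + k2 - i) \<in> G 1" if "i \<le> k1 + k2" for i
  proof (cases "i \<ge> k1")
    case True
    have "x ^ i * (of_nat ((k1 + k2) choose i) * y ^ (k1 + k2 - i)) \<in> G 1"
      using B(2) True
      by (intro k1 bounded_subringD(3)[OF B(1)] bounded_subring_props(5,6)[OF B(1)]) auto
    thus ?thesis
      by (simp add: mult_ac)
  next
    case False
    have "y ^ (k1 + k2 - i) * (of_nat ((k1 + k2) choose i) * x ^ i) \<in> G 1"
      using B(2) False
      by (intro k2 bounded_subringD(3)[OF B(1)] bounded_subring_props(5,6)[OF B(1)]) auto
    thus ?thesis
      by (simp add: mult_ac)
  qed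
  hence "(x + y) ^ (k1 + k2) \<in> G 1"
    unfolding binomial_ring by (intro G_sum) auto
  thus ?thesis
    using x y by (auto simp: M_def add_mem)
qed

lemma M_zero: "0 \<in> M"
  using G_zero G1_subset_M by blast

lemma M_diff: "x - y \<in> M" if "x \<in> M" "y \<in> M"
  using M_add[OF that(1) M_absorb[OF that(2) A_minus[OF A_one]]] by simp

lemma M_sum: "(\<And>i. i \<in> I \<Longrightarrow> f i \<in> M) \<Longrightarrow> sum f I \<in> M"
  by (induction I rule: infinite_finite_induct) (auto simp: M_zero M_add)

lemma X_in_M: "e fls_X \<in> M"
proof -
  obtain N where N: "1 \<in> G N"
    using G_exhaust one_mem by blast
  have "e fls_X ^ k \<in> G (N + int k)" for k
  proof (induction k)
    case (Suc k)
    thus ?case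
      using G_X[of "e fls_X ^ k" "N + int k"] by (simp add: add_ac)
  qed (use N in simp)
  from this[of "nat (1 - N)"] have "e fls_X ^ nat (1 - N) \<in> G 1"
    by (rule G_le) simp
  thus ?thesis
    using base_mem by (auto simp: M_def)
qed

text \<open>First \<open>w = n ^ k\<close> in \<open>G 1\<close> is treated. The inverse
  \<open>z\<close> of \<open>1 - w\<close> satisfies
  \<open>z ^ Suc j = z ^ j + w * z ^ Suc j\<close>, so all its powers stay at the level of 1. A
  finite geometric sum passes from \<open>1 - w\<close> to \<open>1 - n\<close>.\<close>

lemma inverse_one_minus_M:
  assumes n: "n \<in> M"
  shows "n \<noteq> 1" "inverse (1 - n) \<in> A"
proof -
  show "n \<noteq> 1"
    using n one_notin_M by auto
  obtain k where k: "n ^ k \<in> G 1"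
    using n by (auto simp: M_def)
  define w z where "w = n ^ k" and "z = inverse (1 - w)"
  have w: "w \<in> G 1" "w \<in> M"
    using k G1_subset_M by (auto simp: w_def)
  have w1: "1 - w \<noteq> 0"
    using w(2) one_notin_M by auto
  have z: "z \<in> T"
    using w G_subset by (auto simp: z_def intro!: inverse_mem diff_mem one_mem)
  \<comment> \<open>Multiplication by \<open>w\<close> gains one level, so \<open>y\<close> climbs
    from its initial level \<open>N'\<close> until it reaches that of \<open>c\<close>.\<close>
  have fixpoint: "y \<in> G N" if y: "y \<in> T" "y = c + w * y" "c \<in> G N" for y c N
  proof -
    obtain N' where N': "y \<in> G N'"
      using G_exhaust y(1) by blast
    have "y \<in> G (min N (N' + int j))" for j
    proof (induction j)
      case 0
      show ?case
        using N' G_mono[of "min N N'" N'] by auto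
    next
      case (Suc j)
      have "w * y \<in> G (1 + min N (N' + int j))"
        using w(1) Suc by (intro G_mult)
      hence "w * y \<in> G (min N (N' + int (Suc j)))"
        by (rule G_le) simp
      moreover have "c \<in> G (min N (N' + int (Suc j)))"
        using y(3) by (rule G_le) simp
      ultimately show ?case
        using G_add y(2) by metis
    qed
    from this[of "nat (N - N')"] show ?thesis
      by (simp add: min_def split: if_splits)
  qed
  obtain N where N: "1 \<in> G N"
    using G_exhaust one_mem by blast
  have "z ^ j \<in> G N" for j
  proof (induction j)
    case (Suc j)
    have "z * (1 - w) = 1"
      using w1 by (simp add: z_def)
    hence "z - 1 = w * z"
      by (simp add: algebra_simps)
    hence "w * z ^ Suc j = (z - 1) * z ^ j"
      by (simp add: mult.assoc)
    hence "z ^ Suc j = z ^ j + w * z ^ Suc j"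
      by (simp add: algebra_simps)
    thus ?case
      by (rule fixpoint[OF power_mem[OF z] _ Suc.IH])
  qed (use N in simp)
  hence zA: "z \<in> A"
    using z by (auto simp: A_def)
  have nA: "n \<in> A"
    using n M_subset_A by auto
  have "(1 - n) * ((\<Sum>i<k. n ^ i) * z) = (1 - w) * z"
    by (simp only: w_def one_diff_power_eq mult.assoc)
  also have "\<dots> = 1"
    using w1 by (simp add: z_def)
  finally have "inverse (1 - n) = (\<Sum>i<k. n ^ i) * z"
    by (rule inverse_unique)
  thus "inverse (1 - n) \<in> A"
    using zA nA by (auto intro!: A_mult A_sum A_power)
qed


section \<open>Hensel's lemma and its consequences\<close>

lemma poly_diff_factor:
  assumes B: "bounded_subring B" and xy: "x \<in> B" "y \<in> B"
    and p: "\<And>i. Polynomial.coeff p i \<in> B"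
  shows "\<exists>r\<in>B. poly p x - poly p y = (x - y) * r"
  using p
proof (induction p)
  case 0
  thus ?case
    using bounded_subring_props(1)[OF B] by auto
next
  case (pCons a p)
  have coeff: "Polynomial.coeff p i \<in> B" for i
    using pCons.prems[of "Suc i"] by simp
  then obtain r where r: "r \<in> B" "poly p x - poly p y = (x - y) * r"
    using pCons.IH by blast
  have "poly (pCons a p) x - poly (pCons a p) y = (x - y) * poly p x + y * (poly p x - poly p y)"
    by (simp add: algebra_simps)
  also have "\<dots> = (x - y) * (poly p x + y * r)"
    by (simp add: r(2) algebra_simps)
  finally show ?case
    using r(1) coeff B xy bounded_subringD(2,3)[OF B] poly_mem_bounded_subring
    by (intro bexI[of _ "poly p x + y * r"]) auto
qed

text \<open>This is Hensel's lemma for a simple root at 0 modulo \<open>M\<close>, normalized by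
  dividing by the linear coefficient. The iterates from 0 are all multiples of \<open>n\<close>, so
  the factor \<open>y ^ 2\<close> gains another \<open>n\<close> at each step; successive
  differences are divisible by growing powers of \<open>n\<close>, with cofactors in a bounded
  ring.\<close>

lemma hensel:
  assumes n: "n \<in> M" and c: "c \<in> A" and q: "\<And>i. Polynomial.coeff q i \<in> A"
  shows "\<exists>y\<in>M. y = c * n + y ^ 2 * poly q y"
proof -
  have nA: "n \<in> A"
    using n M_subset_A by auto
  obtain B where B: "bounded_subring B"
    and sub: "insert n (insert c (Polynomial.coeff q ` {..Polynomial.degree q})) \<subseteq> B"
    by (rule finite_subset_bounded_subring[of
          "insert n (insert c (Polynomial.coeff q ` {..Polynomial.degree q}))"])
       (use c q nA in auto)
  have nB: "n \<in> B" and cB: "c \<in> B"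
    using sub by auto
  have qB: "Polynomial.coeff q i \<in> B" for i
    using sub bounded_subring_props(1)[OF B]
    by (cases "i \<le> Polynomial.degree q") (auto simp: coeff_eq_0)
  note B_simps = bounded_subringD(2,3)[OF B]
  define \<Phi> where "\<Phi> y = c * n + y ^ 2 * poly q y" for y
  define u where "u j = (\<Phi> ^^ j) 0" for j
  have u_Suc: "u (Suc j) = \<Phi> (u j)" for j
    by (simp add: u_def)
  have u_mult: "\<exists>b\<in>B. u j = n * b" for j
  proof (induction j)
    case 0
    thus ?case
      using bounded_subring_props(1)[OF B] by (auto simp: u_def)
  next
    case (Suc j)
    then obtain b where b: "b \<in> B" "u j = n * b"
      by auto
    have "u (Suc j) = n * (c + b * (n * b) * poly q (n * b))"
      by (simp add: u_Suc \<Phi>_def b(2) algebra_simps power2_eq_square)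
    thus ?case
      using b(1) nB cB by (auto intro!: bexI B_simps poly_mem_bounded_subring[OF B] qB)
  qed
  have uB: "u j \<in> B" for j
    using u_mult[of j] nB B_simps by auto
  have diff: "\<exists>b\<in>B. u (Suc j) - u j = n ^ Suc j * b" for j
  proof (induction j)
    case 0
    thus ?case
      using cB by (auto simp: u_def \<Phi>_def intro!: bexI[of _ c])
  next
    case (Suc j)
    then obtain b where b: "b \<in> B" "u (Suc j) - u j = n ^ Suc j * b"
      by auto
    obtain x y where xy: "x \<in> B" "u (Suc j) = n * x" "y \<in> B" "u j = n * y"
      using u_mult[of "Suc j"] u_mult[of j] by blast
    obtain r where r: "r \<in> B"
        "poly q (u (Suc j)) - poly q (u j) = (u (Suc j) - u j) * r"
      using poly_diff_factor[OF B uB uB qB] by blast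
    \<comment> \<open>The new factor \<open>n\<close> comes from
      \<open>u (Suc j) + u j = n * (x + y)\<close> in the first summand and from
      \<open>(u j) ^ 2 = n * y * u j\<close> in the second.\<close>
    let ?s = "(x + y) * poly q (u (Suc j)) + y * u j * r"
    have "u (Suc (Suc j)) - u (Suc j) =
        (u (Suc j) - u j) * (u (Suc j) + u j) * poly q (u (Suc j)) +
        (u j) ^ 2 * (poly q (u (Suc j)) - poly q (u j))"
      by (simp only: u_Suc[of "Suc j"] u_Suc[of j] \<Phi>_def[of "\<Phi> (u j)"] \<Phi>_def[of "u j", folded u_Suc])
         (simp add: u_Suc[symmetric] \<Phi>_def algebra_simps power2_eq_square)
    also have "\<dots> = (u (Suc j) - u j) * n * ?s"
      unfolding r(2) by (simp only: xy(2,4)) (simp add: algebra_simps power2_eq_square)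
    also have "\<dots> = n ^ Suc (Suc j) * (b * ?s)"
      by (simp add: b(2) algebra_simps)
    finally show ?case
      using b(1) xy(1,3) r(1) uB
      by (auto intro!: bexI B_simps poly_mem_bounded_subring[OF B] qB)
  qed
  have "eventually (\<lambda>j. u (Suc j) - u j \<in> G N) sequentially" for N
  proof -
    obtain k0 where k0: "\<And>k b. k \<ge> k0 \<Longrightarrow> b \<in> B \<Longrightarrow> n ^ k * b \<in> G N"
      using M_power_absorbs[OF B nB n, of N] by auto
    have "u (Suc j) - u j \<in> G N" if "j \<ge> k0" for j
      using diff[of j] k0[of "Suc j"] that by auto
    thus ?thesis
      by (auto simp: eventually_sequentially)
  qed
  then obtain y where y: "y \<in> T" "\<And>N. eventually (\<lambda>j. u j - y \<in> G N) sequentially"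
    using G_complete[of u] uB bounded_subringD(5)[OF B] by blast
  obtain j where "u j - y \<in> G 1"
    using y(2)[of 1] by (auto simp: eventually_sequentially)
  hence "u j - y \<in> M"
    using G1_subset_M by blast
  moreover have "u j \<in> M"
    using u_mult[of j] M_absorb[OF n] bounded_subring_subset_A[OF B] by auto
  ultimately have yM: "y \<in> M"
    using M_diff[of "u j" "u j - y"] by simp
  \<comment> \<open>With the limit adjoined, the cofactor of \<open>u j - y\<close> in the
    difference of the values of \<open>\<Phi>\<close> has a bound \<open>N'\<close> independent of
    \<open>j\<close>. Hence the level \<open>N - N'\<close> required for \<open>j2\<close>
    below.\<close>
  obtain B' where B': "bounded_subring B'" "B \<subseteq> B'" "y \<in> B'"
    using bounded_subring_adjoin[OF B, of y] yM M_subset_A by blast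
  obtain N' where N': "B' \<subseteq> G N'"
    using bounded_subringD(4)[OF B'(1)] by blast
  have "y - \<Phi> y \<in> G N" for N
  proof -
    let ?Q = "pCons (c * n) (pCons 0 q)"
    have \<Phi>: "\<Phi> x = poly ?Q x" for x
      by (simp add: \<Phi>_def power2_eq_square algebra_simps)
    have QB: "Polynomial.coeff ?Q i \<in> B'" for i
      using B'(2) nB cB qB B_simps bounded_subring_props(1)[OF B]
      by (auto simp: coeff_pCons split: nat.splits)
    obtain j1 where j1: "\<And>j. j \<ge> j1 \<Longrightarrow> u j - y \<in> G N"
      using y(2)[of N] by (auto simp: eventually_sequentially)
    obtain j2 where j2: "\<And>j. j \<ge> j2 \<Longrightarrow> u j - y \<in> G (N - N')"
      using y(2)[of "N - N'"] by (auto simp: eventually_sequentially)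
    define j where "j = max j1 j2"
    obtain s where s: "s \<in> B'" "\<Phi> (u j) - \<Phi> y = (u j - y) * s"
      using poly_diff_factor[OF B'(1) _ B'(3) QB, of "u j"] uB B'(2) unfolding \<Phi> by blast
    have "(u j - y) * s \<in> G (N - N' + N')"
      using s(1) N' j2[of j] by (intro G_mult) (auto simp: j_def)
    hence "(u j - y) * s - (u (Suc j) - y) \<in> G N"
      using j1[of "Suc j"] by (intro G_diff[of _ N "u (Suc j) - y"]) (simp_all add: j_def)
    also have "(u j - y) * s - (u (Suc j) - y) = y - \<Phi> y"
      by (simp add: s(2)[symmetric] u_Suc)
    finally show ?thesis .
  qed
  hence "y - \<Phi> y = 0"
    by (rule G_separated)
  thus ?thesis
    using yM by (auto simp: \<Phi>_def)
qed

text \<open>The polynomial \<open>Y^2 - Y + b (1 - b)\<close> has exactly the roots \<open>b\<close>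
  and \<open>1 - b\<close>, and Hensel's lemma finds a root in \<open>M\<close>.\<close>

lemma idempotent_mod_M:
  assumes b: "b \<in> A" and idem: "b * (1 - b) \<in> M"
  shows "b \<in> M \<or> 1 - b \<in> M"
proof -
  have "Polynomial.coeff (1 :: 'c poly) i \<in> A" for i
    using A_zero A_one by (cases "i = 0") auto
  then obtain y where y: "y \<in> M" "y = 1 * (b * (1 - b)) + y ^ 2 * poly 1 y"
    using hensel[OF idem A_one, of 1] by blast
  have "(y - b) * (y - (1 - b)) = y ^ 2 - y + b * (1 - b)"
    by (simp add: algebra_simps power2_eq_square)
  also have "\<dots> = (1 * (b * (1 - b)) + y ^ 2 * poly 1 y) - y"
    by simp
  also have "\<dots> = 0"
    by (simp only: y(2)[symmetric] diff_self)
  finally have "y = b \<or> y = 1 - b"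
    by simp
  thus ?thesis
    using y(1) by auto
qed

text \<open>
  Expanding \<open>(1 + y)\<^sup>m = 1 + n\<close> gives \<open>y = n/m - y\<^sup>2 r(y)/m\<close>, which is an instance of the
  fixed-point equation above.
\<close>
lemma one_plus_M_power:
  assumes n: "n \<in> M" and m: "of_nat m \<noteq> (0 :: 'a)"
  shows "\<exists>y\<in>M. 1 + n = (1 + y) ^ m"
proof -
  let ?i = "e (fls_const (inverse (of_nat m)))"
  have iA: "?i \<in> A"
    by (intro A_base) simp
  have "of_nat m = e (fls_const (of_nat m))"
    by (simp add: hom_of_nat flip: fls_of_nat)
  hence inv: "of_nat m * ?i = 1"
    using m by (simp flip: hom_mult)
  \<comment> \<open>\<open>r\<close> is the binomial expansion beyond its linear term, divided by
    \<open>y ^ 2\<close>. Multiplication by \<open>1 + y\<close> replaces it by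
    \<open>k + r + y r\<close>.\<close>
  have "\<exists>r. (\<forall>i. Polynomial.coeff r i \<in> A) \<and> (\<forall>y::'c. (1 + y) ^ k = 1 + of_nat k * y + y ^ 2 * poly r y)"
    for k
  proof (induction k)
    case 0
    show ?case
      using A_zero by (intro exI[of _ 0]) auto
  next
    case (Suc k)
    then obtain r where r: "\<And>i. Polynomial.coeff r i \<in> A"
        "\<And>y. (1 + y) ^ k = 1 + of_nat k * y + y ^ 2 * poly r y"
      by blast
    have of_nat: "of_nat k \<in> A"
      using A_base[of "of_nat k"] by (simp add: hom_of_nat)
    have "Polynomial.coeff ([:of_nat k:] + r + pCons 0 r) i \<in> A" for i
      using r(1) of_nat A_zero by (auto simp: coeff_pCons split: nat.splits intro!: A_add)
    moreover have "(1 + y) ^ Suc k = 1 + of_nat (Suc k) * y + y ^ 2 * poly ([:of_nat k:] + r + pCons 0 r) y"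
      for y
      by (simp add: r(2) algebra_simps power2_eq_square)
    ultimately show ?case
      by blast
  qed
  then obtain r where r: "\<And>i. Polynomial.coeff r i \<in> A"
      "\<And>y::'c. (1 + y) ^ m = 1 + of_nat m * y + y ^ 2 * poly r y"
    by blast
  have "Polynomial.coeff (smult (- ?i) r) i \<in> A" for i
    using r(1) iA by (auto intro!: A_mult A_minus)
  then obtain y where y: "y \<in> M" "y = ?i * n + y ^ 2 * poly (smult (- ?i) r) y"
    using hensel[OF n iA] by blast
  have "of_nat m * y = (of_nat m * ?i) * n - (of_nat m * ?i) * (y ^ 2 * poly r y)"
    by (subst y(2)) (simp add: algebra_simps)
  hence "(1 + y) ^ m = 1 + n"
    unfolding r(2) inv by simp
  thus ?thesis
    using y(1) by metis
qed

text \<open>There is one element more than the dimension, hence a relation. Dividing it by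
  \<open>t^s\<close>, where \<open>s\<close> is the least order of a nonzero coefficient, leaves
  power series with some nonzero constant term.\<close>

lemma primitive_dependency:
  assumes f: "\<And>i. i \<le> vs.dim T \<Longrightarrow> f i \<in> T"
  obtains c where "\<And>i. fls_subdegree (c i) \<ge> 0" "\<exists>i\<le>vs.dim T. fls_nth (c i) 0 \<noteq> 0"
    "(\<Sum>i\<le>vs.dim T. e (c i) * f i) = 0"
proof -
  let ?n = "vs.dim T"
  obtain c where c: "\<exists>i<Suc ?n. c i \<noteq> 0" "(\<Sum>i<Suc ?n. e (c i) * f i) = 0"
    using family_dependent[of "Suc ?n" f] f by auto
  define D where "D = {i. i \<le> ?n \<and> c i \<noteq> 0}"
  have D: "finite D" "D \<noteq> {}"
    using c(1) by (auto simp: D_def less_Suc_eq_le)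
  define s where "s = Min (fls_subdegree ` c ` D)"
  have "s \<in> fls_subdegree ` c ` D"
    unfolding s_def using D by (intro Min_in) auto
  then obtain i0 where i0: "i0 \<in> D" "fls_subdegree (c i0) = s"
    by auto
  define d where "d i = (if i \<in> D then fls_shift s (c i) else 0)" for i
  have d: "d i = fls_X_intpow (- s) * c i" if "i \<le> ?n" for i
    using that fls_X_intpow_times_conv_shift(1)[of "- s" "c i"] by (auto simp: d_def D_def)
  have "fls_subdegree (d i) \<ge> 0" for i
  proof (cases "i \<in> D")
    case True
    hence "s \<le> fls_subdegree (c i)"
      unfolding s_def using D by (intro Min_le) auto
    thus ?thesis
      using True by (simp add: d_def fls_shift_nonneg_subdegree)
  qed (simp add: d_def)
  moreover have "i0 \<le> ?n" and ci0: "c i0 \<noteq> 0"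
    using i0(1) by (auto simp: D_def)
  moreover have nth: "fls_nth (d i0) 0 = fls_nth (c i0) (fls_subdegree (c i0))"
    unfolding d_def i0(2) using i0(1) by simp
  have "fls_nth (d i0) 0 \<noteq> 0"
    unfolding nth by (rule nth_fls_subdegree_nonzero[OF ci0])
  moreover have "(\<Sum>i\<le>?n. e (d i) * f i) = 0"
  proof -
    have "(\<Sum>i\<le>?n. e (d i) * f i) = (\<Sum>i\<le>?n. e (fls_X_intpow (- s)) * (e (c i) * f i))"
      by (intro sum.cong refl) (simp only: atMost_iff d hom_mult mult.assoc)
    also have "\<dots> = 0"
      using c(2) by (simp only: sum_distrib_left[symmetric] lessThan_Suc_atMost mult_zero_right)
    finally show ?thesis .
  qed
  ultimately show ?thesis
    by (intro that[of d]) auto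
qed

text \<open>What remains after removing the constant term is \<open>t\<close> times a power series,
  and \<open>t\<close> lies in \<open>M\<close>.\<close>

lemma reduce_mod_M:
  assumes "fls_subdegree f \<ge> 0"
  shows "e f - e (fls_const (fls_nth f 0)) \<in> M"
proof -
  let ?g = "fls_shift 1 (f - fls_const (fls_nth f 0))"
  have "fls_nth ?g n = 0" if "n < 0" for n
  proof (cases "n + 1 = 0")
    case False
    hence "n + 1 < fls_subdegree f"
      using assms that by linarith
    hence "fls_nth f (n + 1) = 0"
      by (rule fls_eq0_below_subdegree)
    thus ?thesis
      using False by (simp only: fls_shift_nth fls_minus_nth fls_const_nth if_False diff_0_right)
  qed (simp only: fls_shift_nth fls_minus_nth fls_const_nth if_True diff_self simp_thms)
  hence "vanishes_below 0 ?g"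
    by (simp add: vanishes_below_def)
  hence "e ?g \<in> A"
    by (intro A_base) (simp add: vanishes_below_0_iff)
  hence "e fls_X * e ?g \<in> M"
    using X_in_M by (intro M_absorb)
  also have "e fls_X * e ?g = e f - e (fls_const (fls_nth f 0))"
  proof -
    have "fls_X * ?g = f - fls_const (fls_nth f 0)"
      by (simp only: fls_X_times_conv_shift fls_shift_fls_shift) simp
    thus ?thesis
      by (simp only: hom_mult[symmetric] hom_diff[symmetric])
  qed
  finally show ?thesis .
qed

text \<open>A primitive relation stays nontrivial when its coefficients are reduced to their
  constant terms. So the residue degree is at most the dimension of \<open>T\<close>.\<close>

lemma residue_dependency:
  assumes f: "\<And>i. i \<le> vs.dim T \<Longrightarrow> f i \<in> A"
  obtains c :: "nat \<Rightarrow> 'a" where "\<exists>i\<le>vs.dim T. c i \<noteq> 0"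
    "(\<Sum>i\<le>vs.dim T. e (fls_const (c i)) * f i) \<in> M"
proof -
  obtain c where c: "\<And>i. fls_subdegree (c i) \<ge> 0" "\<exists>i\<le>vs.dim T. fls_nth (c i) 0 \<noteq> 0"
    "(\<Sum>i\<le>vs.dim T. e (c i) * f i) = 0"
    using primitive_dependency[of f] f A_subset by blast
  have "(\<Sum>i\<le>vs.dim T. (e (c i) - e (fls_const (fls_nth (c i) 0))) * f i) \<in> M"
    using f c(1) by (intro M_sum M_absorb reduce_mod_M) auto
  hence "- (\<Sum>i\<le>vs.dim T. e (fls_const (fls_nth (c i) 0)) * f i) \<in> M"
    using c(3) by (simp add: left_diff_distrib sum_subtractf)
  hence "(\<Sum>i\<le>vs.dim T. e (fls_const (fls_nth (c i) 0)) * f i) \<in> M"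
    using M_diff[OF M_zero] by fastforce
  thus ?thesis
    using c(2) by (intro that[of "\<lambda>i. fls_nth (c i) 0"])
qed

end

section \<open>\<open>A\<close> is a local ring and a valuation ring\<close>

lemma coeff_sum_monom:
  "Polynomial.coeff (\<Sum>k<n. Polynomial.monom (g k) k) i = (if i < n then g i else 0)"
  by (simp add: coeff_sum sum.delta if_distrib cong: if_cong)

text \<open>The largest power of \<open>X\<close> is split off. The memberships in the range record
  that no new coefficients arise, so they remain constants of \<open>K\<close> in the
  application.\<close>

lemma poly_split_X_power:
  assumes "p \<noteq> (0 :: 'c::field poly)"
  obtains j c r where "c \<noteq> 0" "c \<in> range (Polynomial.coeff p)"
    "\<And>i. Polynomial.coeff r i \<in> range (Polynomial.coeff p)"
    "\<And>x. poly p x = x ^ j * (c + x * poly r x)"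
proof -
  have "\<exists>j c r. c \<noteq> 0 \<and> c \<in> range (Polynomial.coeff p) \<and>
      (\<forall>i. Polynomial.coeff r i \<in> range (Polynomial.coeff p)) \<and>
      (\<forall>x. poly p x = x ^ j * (c + x * poly r x))"
    using assms
  proof (induction p)
    case (pCons a p)
    have ran: "Polynomial.coeff p i \<in> range (Polynomial.coeff (pCons a p))" for i
      by (intro range_eqI[of _ _ "Suc i"]) simp
    show ?case
    proof (cases "a = 0")
      case True
      hence "p \<noteq> 0"
        using pCons.prems by auto
      then obtain j c r where *: "c \<noteq> 0" "c \<in> range (Polynomial.coeff p)"
          "\<And>i. Polynomial.coeff r i \<in> range (Polynomial.coeff p)"
          "\<And>x. poly p x = x ^ j * (c + x * poly r x)"
        using pCons.IH by metis
      have "poly (pCons a p) x = x ^ Suc j * (c + x * poly r x)" for x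
        by (simp add: *(4) True)
      moreover have "c \<in> range (Polynomial.coeff (pCons a p))"
          "\<And>i. Polynomial.coeff r i \<in> range (Polynomial.coeff (pCons a p))"
        using *(2,3) ran by (metis imageE)+
      ultimately show ?thesis
        using *(1) by blast
    next
      case False
      have "a \<in> range (Polynomial.coeff (pCons a p))"
        by (intro range_eqI[of _ _ 0]) simp
      moreover have "poly (pCons a p) x = x ^ 0 * (a + x * poly p x)" for x
        by simp
      ultimately show ?thesis
        using False ran by blast
    qed
  qed auto
  thus ?thesis
    using that by blast
qed

context filtered_extension
begin

text \<open>
  Modulo \<open>M\<close>, the element \<open>a\<close> satisfies a polynomial equation \<open>a\<^sup>j (c + a r(a)) = 0\<close> over the
  coefficient field with \<open>c \<noteq> 0\<close>. Hence \<open>- a r(a)/c\<close> is idempotent modulo \<open>M\<close>, and so it is \<open>0\<close>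
  or \<open>1\<close> there.
\<close>
lemma A_local:
  assumes a: "a \<in> A" "a \<notin> M"
  shows "inverse a \<in> A"
proof -
  obtain c :: "nat \<Rightarrow> 'a" where c: "\<exists>i\<le>vs.dim T. c i \<noteq> 0"
    "(\<Sum>i\<le>vs.dim T. e (fls_const (c i)) * a ^ i) \<in> M"
    using residue_dependency[of "\<lambda>i. a ^ i"] A_power[OF a(1)] by blast
  define p where "p = (\<Sum>i\<le>vs.dim T. Polynomial.monom (e (fls_const (c i))) i)"
  have coeff: "Polynomial.coeff p i = (if i \<le> vs.dim T then e (fls_const (c i)) else 0)" for i
    by (simp add: p_def coeff_sum sum.delta if_distrib cong: if_cong)
  have pa: "poly p a \<in> M"
    using c(2) by (simp add: p_def poly_sum poly_monom)
  have "p \<noteq> 0"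
    using c(1) by (auto simp: poly_eq_iff coeff)
  have coeff_const: "z \<in> range (\<lambda>x. e (fls_const x))" if "z \<in> range (Polynomial.coeff p)" for z
  proof -
    obtain i where i: "z = Polynomial.coeff p i"
      using \<open>z \<in> range (Polynomial.coeff p)\<close> by blast
    show ?thesis
    proof (cases "i \<le> vs.dim T")
      case False
      hence "z = e (fls_const 0)"
        using i coeff by simp
      thus ?thesis
        by blast
    qed (use i coeff in auto)
  qed
  obtain j d r where d: "d \<noteq> 0" "d \<in> range (Polynomial.coeff p)"
    and r: "\<And>i. Polynomial.coeff r i \<in> range (Polynomial.coeff p)"
    and p_eq: "\<And>x. poly p x = x ^ j * (d + x * poly r x)"
    using poly_split_X_power[OF \<open>p \<noteq> 0\<close>] by metis
  obtain d' where d': "d = e (fls_const d')"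
    using coeff_const[OF d(2)] by blast
  have "inverse d = e (fls_const (inverse d'))"
    by (simp add: d' fls_inverse_const flip: hom_inverse)
  hence dA: "inverse d \<in> A"
    by (simp add: A_base)
  have rA: "Polynomial.coeff r i \<in> A" for i
    using coeff_const[OF r[of i]] A_base by auto
  have raA: "poly r a \<in> A"
    using A_poly[OF rA a(1)] .
  define s where "s = - (poly r a * inverse d)"
  define b where "b = a * s"
  have sA: "s \<in> A"
    using raA dA by (auto simp: s_def intro!: A_minus A_mult)
  have bA: "b \<in> A"
    using sA a by (auto simp: b_def intro!: A_mult)
  have b1: "1 - b = (d + a * poly r a) * inverse d"
    using d(1) by (simp add: b_def s_def algebra_simps)
  have b1A: "1 - b \<in> A"
    using bA A_one by (intro A_diff)
  have ab: "a ^ j * (1 - b) \<in> M"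
    using M_absorb[OF pa dA] by (simp add: b1 p_eq mult.assoc)
  \<comment> \<open>As \<open>b\<close> is a multiple of \<open>a\<close>, this power contains the
    factor \<open>a ^ j * (1 - b)\<close> from \<open>ab\<close>; since \<open>M\<close> is radical,
    \<open>b\<close> is idempotent modulo \<open>M\<close>.\<close>
  have "(b * (1 - b)) ^ Suc j = (a ^ j * (1 - b)) * (s ^ j * (1 - b) ^ j * b)"
    by (simp add: b_def power_mult_distrib mult_ac)
  also have "\<dots> \<in> M"
    by (intro M_absorb[OF ab] A_mult A_power sA bA b1A)
  finally have "b * (1 - b) \<in> M"
    using M_radical A_subset A_mult[OF bA b1A] by blast
  \<comment> \<open>If \<open>b\<close> is in \<open>M\<close>, then \<open>1 - b\<close> is a unit,
    which forces \<open>a ^ j\<close> and thus \<open>a\<close> into \<open>M\<close>. Otherwise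
    \<open>b = a * s\<close> is a unit, and so is \<open>a\<close>.\<close>
  from idempotent_mod_M[OF bA this] show ?thesis
  proof
    assume bM: "b \<in> M"
    have "a ^ j * (1 - b) * inverse (1 - b) \<in> M"
      by (rule M_absorb[OF ab inverse_one_minus_M(2)[OF bM]])
    moreover have "1 - b \<noteq> 0"
      using inverse_one_minus_M(1)[OF bM] by simp
    hence "a ^ j * (1 - b) * inverse (1 - b) = a ^ j"
      by (simp only: mult.assoc right_inverse mult_1_right not_False_eq_True)
    ultimately have "a ^ j \<in> M"
      by (simp only:)
    thus ?thesis
      using M_radical a A_subset by blast
  next
    assume "1 - b \<in> M"
    from inverse_one_minus_M[OF this] have "b \<noteq> 0" "inverse b \<in> A"
      by auto
    moreover from this have "inverse a = s * inverse b"
      by (simp add: b_def)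
    ultimately show ?thesis
      using sA by (auto intro!: A_mult)
  qed
qed

lemma unit_notin_M:
  assumes "x \<noteq> 0" "inverse x \<in> A"
  shows "x \<notin> M"
proof
  assume "x \<in> M"
  hence "x * inverse x \<in> M"
    using assms(2) by (intro M_absorb)
  thus False
    using assms(1) one_notin_M by simp
qed

text \<open>Kaplansky, Commutative Rings, Theorem 67.\<close>
lemma A_valuation_aux:
  assumes "\<And>i. Polynomial.coeff p i \<in> A" "\<exists>i. Polynomial.coeff p i \<notin> M"
    and "poly p u = 0" "u \<in> T" "u \<noteq> 0"
  shows "u \<in> A \<or> inverse u \<in> A"
  using assms(1-3)
proof (induction "Polynomial.degree p" arbitrary: p rule: less_induct)
  case less
  note coeff = less.prems(1) and root = less.prems(3)
  let ?n = "Polynomial.degree p"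
  let ?a = "Polynomial.lead_coeff p"
  have p0: "p \<noteq> 0"
    using less.prems(2) M_zero by auto
  have n: "?n > 0"
  proof (rule ccontr)
    assume "\<not> ?n > 0"
    then obtain a where "p = [:a:]"
      using degree_eq_zeroE by blast
    thus False
      using root p0 by simp
  qed
  have eqn: "(\<Sum>i\<le>?n. Polynomial.coeff p i * u ^ i) = 0"
    using root by (simp add: poly_altdef)
  show ?case
  proof (cases "?a \<in> M")
    case False
    hence inv: "inverse ?a \<in> A"
      using A_local coeff by blast
    have "u \<in> A"
    proof (rule A_integrally_closed[OF assms(4)])
      show "Polynomial.lead_coeff (smult (inverse ?a) p) = 1"
        using p0 by simp
      show "Polynomial.coeff (smult (inverse ?a) p) i \<in> A" for i
        using inv coeff by (auto intro!: A_mult)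
      show "poly (smult (inverse ?a) p) u = 0"
        using root by simp
    qed
    thus ?thesis ..
  next
    case True
    \<comment> \<open>A leading coefficient in \<open>M\<close> cannot be divided out. Multiplying
      the equation by \<open>?a ^ (?n - 1)\<close> instead makes it monic in
      \<open>b\<close>.\<close>
    define b where "b = ?a * u"
    have bA: "b \<in> A"
    proof -
      define q where "q = (\<Sum>i<?n. Polynomial.monom (Polynomial.coeff p i * ?a ^ (?n - 1 - i)) i) +
        Polynomial.monom 1 ?n"
      have cq: "Polynomial.coeff q i = (if i < ?n then Polynomial.coeff p i * ?a ^ (?n - 1 - i)
          else if i = ?n then 1 else 0)" for i
        unfolding q_def coeff_add coeff_sum_monom coeff_monom by (cases "i < ?n") auto
      have deg: "Polynomial.degree q = ?n"
      proof (rule antisym)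
        show "Polynomial.degree q \<le> ?n"
          by (rule degree_le) (simp add: cq)
        show "?n \<le> Polynomial.degree q"
          by (rule le_degree) (simp add: cq)
      qed
      have "poly q b = (\<Sum>i<?n. Polynomial.coeff p i * ?a ^ (?n - 1 - i) * b ^ i) + b ^ ?n"
        by (simp add: q_def poly_sum poly_monom)
      also have "(\<Sum>i<?n. Polynomial.coeff p i * ?a ^ (?n - 1 - i) * b ^ i) =
          ?a ^ (?n - 1) * (\<Sum>i<?n. Polynomial.coeff p i * u ^ i)"
        unfolding sum_distrib_left
      proof (intro sum.cong refl)
        fix i assume "i \<in> {..<?n}"
        hence "?a ^ (?n - 1) = ?a ^ (?n - 1 - i) * ?a ^ i"
          by (simp flip: power_add)
        thus "Polynomial.coeff p i * ?a ^ (?n - 1 - i) * b ^ i =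
            ?a ^ (?n - 1) * (Polynomial.coeff p i * u ^ i)"
          by (simp add: b_def power_mult_distrib)
      qed
      also have "b ^ ?n = ?a ^ (?n - 1) * (?a * u ^ ?n)"
        using n by (cases ?n) (simp_all add: b_def power_mult_distrib)
      also have "?a ^ (?n - 1) * (\<Sum>i<?n. Polynomial.coeff p i * u ^ i) + \<dots> =
          ?a ^ (?n - 1) * (\<Sum>i\<le>?n. Polynomial.coeff p i * u ^ i)"
        by (simp add: ring_distribs flip: lessThan_Suc_atMost)
      finally have "poly q b = 0"
        using eqn by simp
      moreover have "b \<in> T"
        using coeff[of ?n] A_subset assms(4) by (auto simp: b_def mult_mem)
      moreover have "Polynomial.coeff q i \<in> A" for i
        using coeff by (auto simp: cq A_zero A_one intro!: A_mult A_power)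
      moreover have "Polynomial.lead_coeff q = 1"
        by (simp add: deg cq)
      ultimately show ?thesis
        by (intro A_integrally_closed[of b q])
    qed
    \<comment> \<open>Since \<open>?a * u ^ ?n = b * u ^ (?n - 1)\<close>, the top term is absorbed
      into the next one and the degree drops.\<close>
    define q where "q = p - Polynomial.monom ?a ?n + Polynomial.monom b (?n - 1)"
    have cq: "Polynomial.coeff q i = (if i < ?n - 1 then Polynomial.coeff p i
        else if i = ?n - 1 then Polynomial.coeff p i + b else 0)" for i
      using n by (auto simp: q_def coeff_eq_0)
    have root': "poly q u = 0"
    proof -
      have "u ^ ?n = u * u ^ (?n - 1)"
        using n by (cases ?n) auto
      thus ?thesis
        using root by (simp add: q_def poly_monom b_def)
    qed
    have coeffq: "Polynomial.coeff q i \<in> A" for i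
      using coeff bA by (auto simp: cq A_zero intro!: A_add)
    have deg: "Polynomial.degree q < ?n"
      using n by (intro degree_lessI) (auto simp: cq)
    show ?thesis
    proof (cases "\<exists>i. Polynomial.coeff q i \<notin> M")
      case True
      thus ?thesis
        using less.hyps[OF deg coeffq _ root'] by blast
    next
      case False
      hence qM: "Polynomial.coeff q i \<in> M" for i
        by blast
      obtain i where i: "Polynomial.coeff p i \<notin> M"
        using less.prems(2) by blast
      \<comment> \<open>Below \<open>?n - 1\<close> the two polynomials agree, so the coefficient of
        \<open>p\<close> outside \<open>M\<close> sits there, and adding \<open>b\<close> moved it
        into \<open>M\<close>. Hence \<open>b\<close> is a unit, and \<open>inverse u\<close> is
        \<open>?a\<close> divided by \<open>b\<close>.\<close>
      have "i = ?n - 1"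
      proof (rule ccontr)
        assume "i \<noteq> ?n - 1"
        then consider "i < ?n - 1" | "i = ?n" | "i > ?n"
          by linarith
        thus False
        proof cases
          case 1
          thus ?thesis
            using qM[of i] i by (simp add: cq)
        next
          case 2
          thus ?thesis
            using i \<open>?a \<in> M\<close> by simp
        next
          case 3
          thus ?thesis
            using i M_zero by (simp add: coeff_eq_0)
        qed
      qed
      moreover have "Polynomial.coeff p (?n - 1) + b \<in> M"
        using qM[of "?n - 1"] by (simp add: cq)
      ultimately have "b \<notin> M"
        using M_diff[of "Polynomial.coeff p i + b" b] i by auto
      hence "inverse b \<in> A"
        using A_local bA by blast
      moreover have "inverse u = ?a * inverse b"
        using p0 by (simp add: b_def)
      ultimately show ?thesis
        using coeff by (auto intro!: A_mult)
    qed
  qed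
qed

text \<open>A primitive relation between the powers of \<open>u\<close> supplies the polynomial: the
  coefficient with nonzero constant term is a unit of \<open>K[[t]]\<close> and so lies outside
  \<open>M\<close>.\<close>

lemma A_valuation:
  assumes u: "u \<in> T" "u \<noteq> 0"
  shows "u \<in> A \<or> inverse u \<in> A"
proof -
  obtain c where c: "\<And>i. fls_subdegree (c i) \<ge> 0" "\<exists>i\<le>vs.dim T. fls_nth (c i) 0 \<noteq> 0"
    "(\<Sum>i\<le>vs.dim T. e (c i) * u ^ i) = 0"
    using primitive_dependency[of "\<lambda>i. u ^ i"] power_mem[OF u(1)] by blast
  define p where "p = (\<Sum>i\<le>vs.dim T. Polynomial.monom (e (c i)) i)"
  have coeff: "Polynomial.coeff p i = (if i \<le> vs.dim T then e (c i) else 0)" for i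
    by (simp add: p_def coeff_sum sum.delta if_distrib cong: if_cong)
  obtain i where i: "i \<le> vs.dim T" "fls_nth (c i) 0 \<noteq> 0"
    using c(2) by blast
  have "fls_subdegree (c i) = 0"
    using c(1)[of i] i(2) by (meson antisym fls_subdegree_leI)
  hence "e (inverse (c i)) \<in> A"
    using i(2) by (intro A_base) (metis fls_inverse_subdegree neg_0_equal_iff_equal order_refl)
  moreover have "c i \<noteq> 0"
    using i(2) by auto
  ultimately have "Polynomial.coeff p i \<notin> M"
    using i(1) unit_notin_M[of "e (c i)"] by (simp add: coeff hom_inverse)
  moreover have "Polynomial.coeff p i \<in> A" for i
    using c(1) by (simp add: coeff A_base A_zero)
  moreover have "poly p u = 0"
    using c(3) by (simp add: p_def poly_sum poly_monom)
  ultimately show ?thesis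
    using u by (intro A_valuation_aux[of p]) auto
qed


subsection \<open>Residue field and value group\<close>

text \<open>A family of maximal length among those independent over \<open>K\<close> modulo
  \<open>M\<close> exists by \<open>residue_dependency\<close>, and it spans.\<close>

lemma residue_spanning:
  obtains r :: nat and f where "\<And>i. i < r \<Longrightarrow> f i \<in> A"
    "\<And>a. a \<in> A \<Longrightarrow> \<exists>c::nat \<Rightarrow> 'a. a - (\<Sum>i<r. e (fls_const (c i)) * f i) \<in> M"
proof -
  define indep where "indep r f \<longleftrightarrow> (\<forall>i<r. f i \<in> A) \<and>
      (\<forall>c::nat \<Rightarrow> 'a. (\<Sum>i<r. e (fls_const (c i)) * f i) \<in> M \<longrightarrow> (\<forall>i<r. c i = 0))" for r f
  have "indep 0 f" for f
    by (simp add: indep_def)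
  moreover have bound: "r \<le> vs.dim T" if indep: "indep r f" for r f
  proof (rule ccontr)
    assume "\<not> r \<le> vs.dim T"
    hence r: "{..vs.dim T} \<subseteq> {..<r}"
      by auto
    obtain c :: "nat \<Rightarrow> 'a" where c: "\<exists>i\<le>vs.dim T. c i \<noteq> 0"
        "(\<Sum>i\<le>vs.dim T. e (fls_const (c i)) * f i) \<in> M"
      by (rule residue_dependency[of f]) (use indep r in \<open>auto simp: indep_def\<close>)
    \<comment> \<open>Padding by zeros turns a relation between the first members into one for the
      whole family.\<close>
    let ?c = "\<lambda>i. if i \<le> vs.dim T then c i else 0"
    have "(\<Sum>i<r. e (fls_const (?c i)) * f i) = (\<Sum>i\<le>vs.dim T. e (fls_const (c i)) * f i)"
      using r by (intro sum.mono_neutral_cong_right) auto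
    hence "(\<Sum>i<r. e (fls_const (?c i)) * f i) \<in> M"
      using c(2) by (simp only:)
    hence "?c i = 0" if "i < r" for i
      using indep that unfolding indep_def by (elim conjE allE[of _ ?c]) blast
    moreover obtain i where "i \<le> vs.dim T" "c i \<noteq> 0"
      using c(1) by blast
    moreover from this have "i < r"
      using r by auto
    ultimately show False
      by (metis (full_types))
  qed
  ultimately have "\<exists>r. (\<exists>f. indep r f) \<and> (\<forall>r'. (\<exists>f. indep r' f) \<longrightarrow> r' \<le> r)"
    using ex_has_greatest_nat[of "\<lambda>r. \<exists>f. indep r f" 0 "\<lambda>r. r" "Suc (vs.dim T)"]
    by (auto simp: less_Suc_eq_le)
  then obtain r f where f: "indep r f" and r: "\<And>r' f'. indep r' f' \<Longrightarrow> r' \<le> r"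
    by blast
  have fA: "f i \<in> A" if "i < r" for i
    using f that by (simp add: indep_def)
  show ?thesis
  proof (rule that[of r f])
    fix a assume a: "a \<in> A"
    have "\<not> indep (Suc r) (f(r := a))"
      using r[of "Suc r"] by auto
    then obtain c :: "nat \<Rightarrow> 'a" where c: "\<exists>i<Suc r. c i \<noteq> 0"
        "(\<Sum>i<Suc r. e (fls_const (c i)) * (f(r := a)) i) \<in> M"
      using fA a unfolding indep_def by (auto simp: less_Suc_eq)
    have c2: "(\<Sum>i<r. e (fls_const (c i)) * f i) + e (fls_const (c r)) * a \<in> M"
      using c(2) by simp
    have cr: "c r \<noteq> 0"
    proof
      assume cr0: "c r = 0"
      hence "\<forall>i<r. c i = 0"
        using c2 f unfolding indep_def by simp
      thus False
        using c(1) cr0 by (auto simp: less_Suc_eq)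
    qed
    let ?d = "\<lambda>i. - (inverse (c r) * c i)"
    have const: "e (fls_const (x * y)) = e (fls_const x) * e (fls_const y)" for x y
      by (simp only: fls_const_mult_const[symmetric] hom_mult)
    have "e (fls_const (inverse (c r))) * e (fls_const (c r)) = 1"
      using cr by (simp flip: const)
    hence "((\<Sum>i<r. e (fls_const (c i)) * f i) + e (fls_const (c r)) * a) * e (fls_const (inverse (c r)))
        = a - (\<Sum>i<r. e (fls_const (?d i)) * f i)"
      by (simp add: const hom_minus sum_negf sum_distrib_left sum_distrib_right ring_distribs mult_ac)
    moreover have "e (fls_const (inverse (c r))) \<in> A"
      by (intro A_base) simp
    ultimately have "a - (\<Sum>i<r. e (fls_const (?d i)) * f i) \<in> M"
      using M_absorb[OF c2] by metis
    thus "\<exists>c. a - (\<Sum>i<r. e (fls_const (c i)) * f i) \<in> M"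
      by (rule exI[of _ ?d])
  qed (rule fA)
qed

section \<open>The residue field\<close>

abbreviation A_ring :: "'c ring" where
  "A_ring \<equiv> ring_of_type_algebra\<lparr>carrier := A\<rparr>"

lemma A_ring_cring: "cring A_ring"
proof -
  interpret D: Ring.field "ring_of_type_algebra :: 'c ring"
    by (rule field_from_type_algebra)
  have minus: "\<ominus>\<^bsub>ring_of_type_algebra\<^esub> x = - x" for x :: 'c
    using D.minus_equality[of "- x" x] by (simp add: ring_of_type_algebra_simps)
  have "subring A ring_of_type_algebra"
    by (rule D.subringI)
       (auto simp: minus ring_of_type_algebra_simps A_one A_minus A_add A_mult)
  hence "subcring A ring_of_type_algebra"
    by (rule D.subcringI')
  thus ?thesis
    using D.subcring_iff[of A] by (simp add: ring_of_type_algebra_simps)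
qed

lemma A_ring_minus: "x \<in> A \<Longrightarrow> \<ominus>\<^bsub>A_ring\<^esub> x = - x"
proof -
  assume x: "x \<in> A"
  interpret R: cring A_ring
    by (rule A_ring_cring)
  show ?thesis
    using x A_minus R.minus_equality[of "- x" x] by (simp add: ring_of_type_algebra_simps)
qed

lemma M_maximalideal: "maximalideal M A_ring"
proof -
  interpret R: cring A_ring
    by (rule A_ring_cring)
  have "subgroup M (add_monoid A_ring)"
    using M_subset_A M_zero M_diff[OF M_zero]
    by (intro R.add.subgroupI)
       (auto simp: A_ring_minus ring_of_type_algebra_simps M_add subset_iff)
  hence ideal: "ideal M A_ring"
    by (rule idealI[OF R.ring_axioms])
       (auto simp: ring_of_type_algebra_simps M_absorb, subst mult.commute, rule M_absorb)
  show ?thesis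
  proof (rule maximalidealI[OF ideal])
    show "carrier A_ring \<noteq> M"
      using A_one one_notin_M by auto
    fix J assume J: "ideal J A_ring" "M \<subseteq> J" "J \<subseteq> carrier A_ring"
    show "J = M \<or> J = carrier A_ring"
    proof (cases "J = M")
      case False
      then obtain x where x: "x \<in> J" "x \<notin> M"
        using J(2) by blast
      have "x \<in> A"
        using x(1) J(3) by auto
      hence "x * inverse x \<in> J"
        using ideal.I_r_closed[OF J(1) x(1), of "inverse x"] A_local[OF _ x(2)]
        by (simp add: ring_of_type_algebra_simps)
      moreover have "x \<noteq> 0"
        using x(2) M_zero by auto
      ultimately have "\<one>\<^bsub>A_ring\<^esub> \<in> J"
        by (simp add: ring_of_type_algebra_simps)
      thus ?thesis
        using ideal.one_imp_carrier[OF J(1)] by blast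
    qed simp
  qed
qed

text \<open>\<open>\<rho>\<close> is the quotient map to \<open>A/M\<close> followed by an embedding
  of that finite extension into the algebraic closure of \<open>K\<close>, where the result on
  finite subextensions applies.\<close>

lemma residue_map:
  obtains \<rho> :: "'c \<Rightarrow> 'a alg_closure" where
    "\<And>x y. x \<in> A \<Longrightarrow> y \<in> A \<Longrightarrow> \<rho> (x * y) = \<rho> x * \<rho> y"
    "\<And>x y. x \<in> A \<Longrightarrow> y \<in> A \<Longrightarrow> \<rho> x = \<rho> y \<longleftrightarrow> x - y \<in> M"
    "\<rho> 0 = 0" "\<rho> 1 = 1" "finite_subextension to_ac (\<rho> ` A)"
proof -
  interpret R: cring A_ring
    by (rule A_ring_cring)
  interpret M: maximalideal M A_ring
    by (rule M_maximalideal)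
  let ?Q = "A_ring Quot M"
  interpret Q: Ring.field ?Q
    by (rule M.quotient_is_field[OF A_ring_cring])
  define \<pi> where "\<pi> x = M +>\<^bsub>A_ring\<^esub> x" for x
  have \<pi>_hom: "\<pi> \<in> ring_hom A_ring ?Q"
    using M.rcos_ring_hom by (simp add: \<pi>_def[abs_def])
  have \<pi>_closed: "\<pi> x \<in> carrier ?Q" if "x \<in> A" for x
    using \<pi>_hom that by (auto simp: ring_hom_def)
  have \<pi>_mult: "\<pi> (x * y) = \<pi> x \<otimes>\<^bsub>?Q\<^esub> \<pi> y" and \<pi>_add: "\<pi> (x + y) = \<pi> x \<oplus>\<^bsub>?Q\<^esub> \<pi> y"
    if "x \<in> A" "y \<in> A" for x y
    using ring_hom_mult[OF \<pi>_hom, of x y] ring_hom_add[OF \<pi>_hom, of x y] that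
    by (simp_all add: ring_of_type_algebra_simps)
  have \<pi>_one: "\<pi> 1 = \<one>\<^bsub>?Q\<^esub>" and \<pi>_zero: "\<pi> 0 = \<zero>\<^bsub>?Q\<^esub>"
    using ring_hom_one[OF \<pi>_hom] ring_hom_zero[OF \<pi>_hom R.ring_axioms Q.ring_axioms]
    by (simp_all add: ring_of_type_algebra_simps)
  have carr: "carrier ?Q = \<pi> ` A"
    by (auto simp: FactRing_def A_RCOSETS_def' \<pi>_def)
  have \<pi>_eq: "\<pi> x = \<pi> y \<longleftrightarrow> x - y \<in> M" if "x \<in> A" "y \<in> A" for x y
    using R.quotient_eq_iff_same_a_r_cos[OF M.ideal_axioms, of x y] that A_ring_minus
    by (simp add: \<pi>_def a_minus_def ring_of_type_algebra_simps)
  let ?k = "\<lambda>a. e (fls_const a)"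
  have kA: "?k a \<in> A" for a
    by (intro A_base) simp
  define h where "h a = \<pi> (?k a)" for a
  have h: "field_extension h ?Q"
    unfolding field_extension_def
  proof (intro conjI Q.field_axioms ring_hom_memI)
    fix a b :: 'a
    have "?k (a * b) = ?k a * ?k b"
      by (simp only: fls_const_mult_const[symmetric] hom_mult)
    thus "h (a \<otimes>\<^bsub>ring_of_type_algebra\<^esub> b) = h a \<otimes>\<^bsub>?Q\<^esub> h b"
      by (simp add: h_def ring_of_type_algebra_simps \<pi>_mult kA)
    have "?k (a + b) = ?k a + ?k b"
      by (simp only: fls_plus_const[symmetric] hom_add)
    thus "h (a \<oplus>\<^bsub>ring_of_type_algebra\<^esub> b) = h a \<oplus>\<^bsub>?Q\<^esub> h b"
      by (simp add: h_def ring_of_type_algebra_simps \<pi>_add kA)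
  qed (simp_all add: h_def \<pi>_closed kA ring_of_type_algebra_simps \<pi>_one)
  note K = field_extension_subfield[OF h]
  obtain r f where f: "\<And>i. i < r \<Longrightarrow> f i \<in> A"
    and span: "\<And>a. a \<in> A \<Longrightarrow> \<exists>c::nat \<Rightarrow> 'a. a - (\<Sum>i<r. e (fls_const (c i)) * f i) \<in> M"
    using residue_spanning by blast
  define Us where "Us = map (\<lambda>i. \<pi> (f i)) [0..<r]"
  have Us: "set Us \<subseteq> carrier ?Q"
    using f \<pi>_closed by (auto simp: Us_def)
  have comb: "\<pi> (\<Sum>i<j. ?k (c i) * f i) \<in> Q.Span (range h) Us" if "j \<le> r" for j c
    using that
  proof (induction j)
    case 0
    show ?case
      using Q.Span_subgroup_props(2)[OF K Us] by (simp add: \<pi>_zero)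
  next
    case (Suc j)
    have "\<pi> (f j) \<in> Q.Span (range h) Us"
      using Q.Span_base_incl[OF K Us] Suc.prems by (auto simp: Us_def)
    hence "h (c j) \<otimes>\<^bsub>?Q\<^esub> \<pi> (f j) \<in> Q.Span (range h) Us"
      by (intro Q.Span_smult_closed[OF K Us]) auto
    moreover have "\<pi> (\<Sum>i<Suc j. ?k (c i) * f i) =
        \<pi> (\<Sum>i<j. ?k (c i) * f i) \<oplus>\<^bsub>?Q\<^esub> (h (c j) \<otimes>\<^bsub>?Q\<^esub> \<pi> (f j))"
    proof -
      have fj: "f j \<in> A" and "(\<Sum>i<j. ?k (c i) * f i) \<in> A"
        using Suc.prems f kA by (auto intro!: A_sum A_mult)
      thus ?thesis
        by (simp only: sum.lessThan_Suc \<pi>_add \<pi>_mult h_def kA A_mult)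
    qed
    ultimately show ?case
      using Suc by (simp only: Q.Span_subgroup_props(3)[OF K Us] Suc_leD)
  qed
  have "carrier ?Q \<subseteq> Q.Span (range h) Us"
  proof
    fix y assume "y \<in> carrier ?Q"
    then obtain a where a: "a \<in> A" "y = \<pi> a"
      using carr by blast
    obtain c :: "nat \<Rightarrow> 'a" where c: "a - (\<Sum>i<r. ?k (c i) * f i) \<in> M"
      using span[OF a(1)] by blast
    have "(\<Sum>i<r. ?k (c i) * f i) \<in> A"
      using f kA by (intro A_sum A_mult) auto
    hence "y = \<pi> (\<Sum>i<r. ?k (c i) * f i)"
      using \<pi>_eq[OF a(1)] c a(2) by blast
    thus "y \<in> Q.Span (range h) Us"
      using comb[of r c] by (simp only: order_refl)
  qed
  hence "Q.Span (range h) Us = carrier ?Q"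
    using Q.Span_subgroup_props(1)[OF K Us] by (intro subset_antisym)
  hence "Q.finite_dimension (range h) (carrier ?Q)"
    using Q.Span_finite_dimension[OF K Us] by (simp only:)
  hence "finite_field_extension h ?Q"
    using h by (simp add: finite_field_extension_def)
  then obtain g where g: "g \<in> ring_hom ?Q (ring_of_type_algebra :: 'a alg_closure ring)"
    and ext: "finite_subextension to_ac (g ` carrier ?Q)"
    using finite_field_extension_embedding by metis
  have D: "Ring.field (ring_of_type_algebra :: 'a alg_closure ring)"
    by (rule field_from_type_algebra)
  have inj: "inj_on g (carrier ?Q)"
    using non_trivial_field_hom_is_inj[OF g Q.field_axioms D] .
  show ?thesis
  proof (rule that[of "\<lambda>x. g (\<pi> x)"])
    show "g (\<pi> (x * y)) = g (\<pi> x) * g (\<pi> y)" if "x \<in> A" "y \<in> A" for x y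
      using ring_hom_mult[OF g] that \<pi>_closed by (simp add: \<pi>_mult ring_of_type_algebra_simps)
    show "g (\<pi> x) = g (\<pi> y) \<longleftrightarrow> x - y \<in> M" if "x \<in> A" "y \<in> A" for x y
      using inj_on_eq_iff[OF inj] that \<pi>_closed \<pi>_eq by metis
    show "g (\<pi> 0) = 0" "g (\<pi> 1) = 1"
      using ring_hom_zero[OF g Q.ring_axioms] ring_hom_one[OF g] Ring.field.is_ring[OF D]
      by (simp_all add: \<pi>_zero \<pi>_one ring_of_type_algebra_simps)
    show "finite_subextension to_ac ((\<lambda>x. g (\<pi> x)) ` A)"
      using ext by (simp add: carr image_image)
  qed
qed


text \<open>The values of \<open>x\<close> and \<open>y\<close> agree modulo the value group of the
  base field; units of \<open>A\<close> stand for value 0, so no value group has to be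
  formed.\<close>

definition value_equiv :: "'c \<Rightarrow> 'c \<Rightarrow> bool" where
  "value_equiv x y \<longleftrightarrow> (\<exists>f a. f \<noteq> 0 \<and> a \<noteq> 0 \<and> a \<in> A \<and> inverse a \<in> A \<and> x = y * e f * a)"

lemma value_equiv_sym: "value_equiv x y \<Longrightarrow> value_equiv y x"
proof -
  assume "value_equiv x y"
  then obtain f a where fa: "f \<noteq> 0" "a \<noteq> 0" "a \<in> A" "inverse a \<in> A" "x = y * e f * a"
    unfolding value_equiv_def by blast
  have "x * e (inverse f) * inverse a = y * (e f * inverse (e f)) * (a * inverse a)"
    by (simp only: fa(5) hom_inverse mult_ac)
  also have "\<dots> = y"
    using fa(1,2) by simp
  finally show ?thesis
    using fa unfolding value_equiv_def
    by (intro exI[of _ "inverse f"] exI[of _ "inverse a"]) simp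
qed

lemma exists_maximal_value:
  assumes "finite Z" "Z \<noteq> {}" "\<And>v. v \<in> Z \<Longrightarrow> z v \<in> T - {0}"
  shows "\<exists>w\<in>Z. \<forall>v\<in>Z. z v / z w \<in> A"
  using assms
proof (induction Z rule: finite_ne_induct)
  case (singleton v)
  thus ?case
    using A_one by auto
next
  case (insert v Z)
  then obtain w where w: "w \<in> Z" "\<And>v. v \<in> Z \<Longrightarrow> z v / z w \<in> A"
    by blast
  have ne: "z v \<noteq> 0" "z w \<noteq> 0" "z v / z w \<in> T"
    using insert.prems w(1) by (auto intro: divide_mem)
  have "z v / z w \<in> A \<or> inverse (z v / z w) \<in> A"
    using ne by (intro A_valuation) auto
  thus ?case
  proof
    assume "z v / z w \<in> A"
    thus ?thesis
      using w by (intro bexI[of _ w]) auto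
  next
    assume inv: "inverse (z v / z w) \<in> A"
    have "z u / z v \<in> A" if "u \<in> Z" for u
    proof -
      have "(z u / z w) * inverse (z v / z w) = z u / z v"
        using ne by simp
      thus ?thesis
        using A_mult[OF w(2)[OF that] inv] by (simp only:)
    qed
    thus ?thesis
      using ne A_one by (intro bexI[of _ v]) auto
  qed
qed

text \<open>
  Elements with values in distinct classes of the value group modulo that of the base field are
  linearly independent: in a vanishing linear combination a single term would have the largest
  absolute value.
\<close>
lemma value_inequiv_independent:
  assumes Y: "finite Y" "Y \<subseteq> T - {0}"
    and inequiv: "\<And>x y. x \<in> Y \<Longrightarrow> y \<in> Y \<Longrightarrow> value_equiv x y \<Longrightarrow> x = y"
  shows "vs.independent Y"
proof
  assume "vs.dependent Y"
  then obtain u where u: "\<exists>v\<in>Y. u v \<noteq> 0" "(\<Sum>v\<in>Y. e (u v) * v) = 0"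
    using vs.dependent_finite[OF Y(1)] by auto
  define Z where "Z = {v\<in>Y. u v \<noteq> 0}"
  define z where "z v = e (u v) * v" for v
  have Z: "finite Z" "Z \<noteq> {}"
    using Y(1) u(1) by (auto simp: Z_def)
  have z: "z v \<in> T - {0}" if "v \<in> Z" for v
  proof -
    have "v \<in> T" "v \<noteq> 0" "u v \<noteq> 0"
      using that Y(2) unfolding Z_def by blast+
    thus ?thesis
      by (simp add: z_def base_mem mult_mem)
  qed
  have "\<exists>w\<in>Z. \<forall>v\<in>Z. z v / z w \<in> A"
    by (intro exists_maximal_value Z z)
  then obtain w where w: "w \<in> Z" "\<forall>v\<in>Z. z v / z w \<in> A"
    by (elim bexE) (rule that)
  have zw: "z w \<noteq> 0"
    using z[OF w(1)] by simp
  \<comment> \<open>A ratio that is a unit of \<open>A\<close> would make \<open>v\<close> and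
    \<open>w\<close> equivalent through the base factor \<open>u w / u v\<close>.\<close>
  have small: "z v / z w \<in> M" if v: "v \<in> Z - {w}" for v
  proof (rule ccontr)
    assume notM: "z v / z w \<notin> M"
    hence inv: "inverse (z v / z w) \<in> A"
      using bspec[OF w(2), of v] v by (intro A_local) simp_all
    have ne: "u v \<noteq> 0" "u w \<noteq> 0" "v \<noteq> 0" "w \<noteq> 0"
      using v w(1) Y(2) unfolding Z_def by blast+
    have "v = w * e (u w / u v) * (z v / z w)"
    proof -
      have "e (u w / u v) = e (u w) / e (u v)"
        by (simp only: field_class.field_divide_inverse hom_mult hom_inverse)
      thus ?thesis
        using ne by (simp add: z_def divide_simps)
    qed
    moreover have "z v / z w \<noteq> 0"
      using notM M_zero by auto
    ultimately have "value_equiv v w"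
      using inv bspec[OF w(2), of v] v ne unfolding value_equiv_def
      by (intro exI[of _ "u w / u v"] exI[of _ "z v / z w"] conjI) simp_all
    thus False
      using inequiv[of v w] v w(1) unfolding Z_def by blast
  qed
  have "(\<Sum>v\<in>Z. z v) = 0"
  proof -
    have "(\<Sum>v\<in>Z. z v) = (\<Sum>v\<in>Y. e (u v) * v)"
      unfolding z_def Z_def using Y(1) by (intro sum.mono_neutral_left) auto
    thus ?thesis
      using u(2) by simp
  qed
  hence "z w + (\<Sum>v\<in>Z - {w}. z v) = 0"
    using Z(1) w(1) by (simp add: sum.remove)
  hence "(z w + (\<Sum>v\<in>Z - {w}. z v)) / z w = 0"
    by simp
  \<comment> \<open>Divided by its dominant term, the relation would put 1 into
    \<open>M\<close>.\<close>
  hence "1 + (\<Sum>v\<in>Z - {w}. z v / z w) = 0"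
    using zw by (simp add: add_divide_distrib sum_divide_distrib)
  hence "1 = 0 - (\<Sum>v\<in>Z - {w}. z v / z w)"
    by (simp add: eq_neg_iff_add_eq_0)
  moreover have "0 - (\<Sum>v\<in>Z - {w}. z v / z w) \<in> M"
    by (intro M_diff M_zero M_sum small)
  ultimately have "1 \<in> M"
    by (simp only:)
  thus False
    using one_notin_M by blast
qed

text \<open>Pairwise inequivalent sets are independent, so their sizes are bounded by the dimension;
  one of largest size meets every class.\<close>

lemma value_group_finite:
  obtains Y where "finite Y" "Y \<subseteq> T - {0}" "\<And>x. x \<in> T - {0} \<Longrightarrow> \<exists>y\<in>Y. value_equiv x y"
proof -
  define P where "P Y \<longleftrightarrow> finite Y \<and> Y \<subseteq> T - {0} \<and> (\<forall>x\<in>Y. \<forall>y\<in>Y. value_equiv x y \<longrightarrow> x = y)" for Y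
  have "P {}"
    by (simp add: P_def)
  moreover have "card Y < Suc (vs.dim T)" if "P Y" for Y
  proof -
    have "vs.independent Y"
      using that unfolding P_def by (intro value_inequiv_independent) auto
    thus ?thesis
      using card_le_dim[of Y] that by (auto simp: P_def less_Suc_eq_le)
  qed
  ultimately obtain Y where Y: "P Y" "\<And>Y'. P Y' \<Longrightarrow> card Y' \<le> card Y"
    using ex_has_greatest_nat[of P "{}" card "Suc (vs.dim T)"] by blast
  have "\<exists>y\<in>Y. value_equiv x y" if x: "x \<in> T - {0}" for x
  proof (rule ccontr)
    assume none: "\<not> (\<exists>y\<in>Y. value_equiv x y)"
    have "value_equiv x x"
      unfolding value_equiv_def by (intro exI[of _ 1]) (simp add: A_one)
    hence "x \<notin> Y"
      using none by blast
    moreover have "P (insert x Y)"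
      using Y(1) x none value_equiv_sym unfolding P_def by blast
    ultimately show False
      using Y(2)[of "insert x Y"] Y(1) by (simp add: P_def)
  qed
  thus ?thesis
    using Y(1) that unfolding P_def by blast
qed

text \<open>Lifts \<open>b\<close> of the residue field representatives suffice: if \<open>a\<close>
  has the same residue as \<open>b * c ^ m\<close>, their quotient lies in \<open>1 + M\<close> and
  is an \<open>m\<close>-th power.\<close>

lemma units_finite_power_reps:
  assumes m: "of_nat m \<noteq> (0 :: 'a)"
    and res: "\<And>S. finite_subextension (to_ac :: 'a \<Rightarrow> 'a alg_closure) S \<Longrightarrow> finite_power_reps m S"
  obtains B where "finite B" "B \<subseteq> T - {0}"
    "\<And>a. a \<in> A \<Longrightarrow> a \<notin> M \<Longrightarrow> \<exists>b\<in>B. \<exists>y\<in>T - {0}. a = b * y ^ m"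
proof -
  obtain \<rho> :: "'c \<Rightarrow> 'a alg_closure" where
    \<rho>_mult: "\<And>x y. x \<in> A \<Longrightarrow> y \<in> A \<Longrightarrow> \<rho> (x * y) = \<rho> x * \<rho> y" and
    \<rho>_eq: "\<And>x y. x \<in> A \<Longrightarrow> y \<in> A \<Longrightarrow> \<rho> x = \<rho> y \<longleftrightarrow> x - y \<in> M" and
    \<rho>_0: "\<rho> 0 = 0" and \<rho>_1: "\<rho> 1 = 1" and ext: "finite_subextension to_ac (\<rho> ` A)"
    using residue_map by blast
  have \<rho>_0_iff: "\<rho> x = 0 \<longleftrightarrow> x \<in> M" if "x \<in> A" for x
    using \<rho>_eq[OF that A_zero] by (simp add: \<rho>_0)
  have \<rho>_power: "\<rho> (x ^ n) = \<rho> x ^ n" if "x \<in> A" for x n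
    using that by (induction n) (simp_all add: \<rho>_1 \<rho>_mult A_power)
  obtain R where R: "finite R" "R \<subseteq> \<rho> ` A - {0}"
      "\<forall>x\<in>\<rho> ` A - {0}. \<exists>r\<in>R. \<exists>y\<in>\<rho> ` A - {0}. x = r * y ^ m"
    using res[OF ext] unfolding finite_power_reps_def by (elim exE conjE) (rule that)
  define l where "l r = (SOME b. b \<in> A \<and> \<rho> b = r)" for r
  have l: "l r \<in> A" "\<rho> (l r) = r" "l r \<notin> M" if "r \<in> R" for r
  proof -
    have "\<exists>b. b \<in> A \<and> \<rho> b = r"
      using R(2) that by auto
    hence *: "l r \<in> A \<and> \<rho> (l r) = r"
      unfolding l_def by (rule someI_ex)
    thus "l r \<in> A" "\<rho> (l r) = r"
      by auto
    have "r \<noteq> 0"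
      using R(2) that by auto
    thus "l r \<notin> M"
      using * \<rho>_0_iff[of "l r"] by simp
  qed
  have nonzero: "x \<noteq> 0" if "x \<notin> M" for x
    using that M_zero by auto
  have "\<exists>b\<in>l ` R. \<exists>y\<in>T - {0}. a = b * y ^ m" if a: "a \<in> A" "a \<notin> M" for a
  proof -
    have "\<rho> a \<in> \<rho> ` A - {0}"
      using a \<rho>_0_iff by auto
    then obtain r s where rs: "r \<in> R" "s \<in> \<rho> ` A - {0}" "\<rho> a = r * s ^ m"
      using R(3) by meson
    obtain c where c: "c \<in> A" "s = \<rho> c"
      using rs(2) by blast
    have cM: "c \<notin> M"
      using rs(2) c \<rho>_0_iff by auto
    define b where "b = l r"
    have b: "b \<in> A" "\<rho> b = r" "b \<notin> M"
      using l[OF rs(1)] by (auto simp: b_def)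
    define d where "d = b * c ^ m"
    have dA: "d \<in> A"
      using b(1) c(1) by (auto simp: d_def intro!: A_mult A_power)
    have "\<rho> d = \<rho> a"
      using b c rs(3) by (simp add: d_def \<rho>_mult \<rho>_power A_power)
    hence ad: "a - d \<in> M" and "d \<notin> M"
      using \<rho>_eq[OF a(1) dA] \<rho>_0_iff[OF dA] \<rho>_0_iff[OF a(1)] a(2) by auto
    hence d: "inverse d \<in> A" "d \<noteq> 0"
      using A_local[OF dA] nonzero by auto
    have "(a - d) * inverse d \<in> M"
      using ad d(1) by (rule M_absorb)
    then obtain y where y: "y \<in> M" "1 + (a - d) * inverse d = (1 + y) ^ m"
      using one_plus_M_power[OF _ m] by blast
    have "a = d * (1 + (a - d) * inverse d)"
      using d(2) by (simp add: algebra_simps)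
    hence "a = d * (1 + y) ^ m"
      unfolding y(2) .
    also have "\<dots> = b * (c * (1 + y)) ^ m"
      by (simp only: d_def power_mult_distrib mult.assoc)
    finally have "a = b * (c * (1 + y)) ^ m" .
    moreover have "1 + y \<noteq> 0"
    proof
      assume "1 + y = 0"
      hence "1 = 0 - y"
        by (simp add: eq_neg_iff_add_eq_0)
      thus False
        using M_diff[OF M_zero y(1)] one_notin_M by (simp only:)
    qed
    moreover have "c * (1 + y) \<in> T"
      using c(1) y(1) M_subset_A A_subset by (intro mult_mem add_mem one_mem) auto
    ultimately show ?thesis
      using rs(1) nonzero[OF cM] by (intro bexI[of _ b] bexI[of _ "c * (1 + y)"]) (auto simp: b_def)
  qed
  moreover have "finite (l ` R)" "l ` R \<subseteq> T - {0}"
    using R(1) l A_subset nonzero by auto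
  ultimately show ?thesis
    using that by blast
qed

text \<open>An element is \<open>y * e f * a\<close> with \<open>y\<close> from the value group
  representatives and \<open>a\<close> a unit. Writing \<open>f\<close> as \<open>t^s\<close> times
  a unit of \<open>K[[t]]\<close>, that unit joins \<open>a\<close>, and only \<open>s\<close>
  modulo \<open>m\<close> matters.\<close>

lemma finite_power_reps_T:
  assumes m: "m > 0" "of_nat m \<noteq> (0 :: 'a)"
    and res: "\<And>S. finite_subextension (to_ac :: 'a \<Rightarrow> 'a alg_closure) S \<Longrightarrow> finite_power_reps m S"
  shows "finite_power_reps m T"
proof -
  obtain Y where Y: "finite Y" "Y \<subseteq> T - {0}" "\<And>x. x \<in> T - {0} \<Longrightarrow> \<exists>y\<in>Y. value_equiv x y"
    using value_group_finite by blast
  obtain B where B: "finite B" "B \<subseteq> T - {0}"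
    "\<And>a. a \<in> A \<Longrightarrow> a \<notin> M \<Longrightarrow> \<exists>b\<in>B. \<exists>y\<in>T - {0}. a = b * y ^ m"
    using units_finite_power_reps[OF m(2) res] by blast
  let ?X = "\<lambda>s. e (fls_X_intpow s)"
  let ?R = "(\<lambda>(y, s, b). y * ?X s * b) ` (Y \<times> {0..<int m} \<times> B)"
  have X_ne: "?X s \<noteq> 0" for s
    by (simp add: fls_X_intpow_nonzero)
  have X_power: "?X (s * int n) = ?X s ^ n" for s n
    by (simp only: fls_X_intpow_power hom_power[symmetric] mult.commute)
  have "\<exists>r\<in>?R. \<exists>y\<in>T - {0}. x = r * y ^ m" if x: "x \<in> T - {0}" for x
  proof -
    obtain y f a where y: "y \<in> Y" and fa: "f \<noteq> 0" "a \<noteq> 0" "a \<in> A" "inverse a \<in> A"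
        "x = y * e f * a"
      using Y(3)[OF x] unfolding value_equiv_def by blast
    define s where "s = fls_subdegree f"
    define g where "g = fls_shift s f"
    have g: "g \<noteq> 0" "fls_subdegree g = 0"
      using fa(1) by (auto simp: g_def s_def fls_shift_eq0_iff)
    have f_eq: "f = fls_X_intpow s * g"
      by (simp add: g_def fls_X_intpow_times_conv_shift)
    define a' where "a' = e g * a"
    have "a' \<in> A"
      using g(2) fa(3) by (auto simp: a'_def intro!: A_mult A_base)
    moreover have "a' \<notin> M"
    proof (rule unit_notin_M)
      show "a' \<noteq> 0"
        using g(1) fa(2) by (simp add: a'_def)
      have "e (inverse g) * inverse a \<in> A"
        using g(2) fa(4) by (intro A_mult A_base) (simp_all add: fls_inverse_subdegree)
      thus "inverse a' \<in> A"
        by (simp add: a'_def hom_inverse)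
    qed
    ultimately obtain b z where bz: "b \<in> B" "z \<in> T - {0}" "a' = b * z ^ m"
      using B(3) by meson
    define q r where "q = s div int m" and "r = s mod int m"
    have r: "r \<in> {0..<int m}"
      using m(1) by (simp add: r_def)
    have "s = r + q * int m"
      by (simp add: q_def r_def)
    hence X_s: "?X s = ?X r * ?X q ^ m"
      by (simp only: fls_X_intpow_times_fls_X_intpow[symmetric] hom_mult X_power)
    have "x = y * ?X s * a'"
      by (simp only: fa(5) f_eq hom_mult a'_def mult.assoc)
    also have "\<dots> = (y * ?X r * b) * (?X q * z) ^ m"
      by (simp only: X_s bz(3) power_mult_distrib mult_ac)
    finally have "x = (y * ?X r * b) * (?X q * z) ^ m" .
    moreover have "y * ?X r * b \<in> ?R"
      using y r bz(1) by (intro image_eqI[of _ _ "(y, r, b)"]) auto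
    moreover have "?X q * z \<in> T - {0}"
      using bz(2) X_ne by (auto intro!: mult_mem base_mem)
    ultimately show ?thesis
      by blast
  qed
  moreover have "finite ?R"
    using Y(1) B(1) by simp
  moreover have "?R \<subseteq> T - {0}"
    using Y(2) B(2) X_ne by (auto intro!: mult_mem base_mem)
  ultimately show ?thesis
    unfolding finite_power_reps_def by (intro exI[of _ ?R] conjI ballI)
qed

end

theorem corollary2p7:
  fixes m :: nat
  assumes "m \<ge> 1"
    and "prime_to_char TYPE('a::field) m"
    and "type_F' TYPE('a) m"
  shows "type_F' TYPE('a fls) m"
  unfolding type_F'_def
proof (intro allI impI)
  fix L :: "'a fls list ring" and h :: "'a fls \<Rightarrow> 'a fls list"
  let ?D = "ring_of_type_algebra :: 'a fls alg_closure ring"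
  assume "finite_separable_extension h L"
  hence ext: "finite_field_extension h L"
    by (simp add: finite_separable_extension_def)
  hence L: "Ring.field L"
    by (simp add: finite_field_extension_def field_extension_def)
  obtain g where g: "g \<in> ring_hom L ?D" and T: "finite_subextension to_ac (g ` carrier L)"
    using finite_field_extension_embedding[OF ext] by metis
  interpret T: finite_subextension to_ac "g ` carrier L"
    by (fact T)
  obtain G where "filtered_extension to_ac (g ` carrier L) G"
    using exists_filtration[OF T] by blast
  then interpret G: filtered_extension to_ac "g ` carrier L" G .
  \<comment> \<open>A positive characteristic coprime to \<open>m\<close> cannot divide it, as the
    characteristic of a field is never 1.\<close>
  have "of_nat m \<noteq> (0 :: 'a)"
  proof (cases "CHAR('a) = 0")
    case False
    hence "coprime m CHAR('a)"
      using assms(2) by (simp add: prime_to_char_def)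
    hence "CHAR('a) dvd m \<Longrightarrow> CHAR('a) = 1"
      using coprime_common_divisor[of m "CHAR('a)" "CHAR('a)"] by simp
    thus ?thesis
      using of_nat_eq_0_iff_char_dvd[where ?'a = 'a, of m]
        of_nat_eq_0_iff_char_dvd[where ?'a = 'a, of 1] by auto
  qed (use assms(1) in \<open>simp add: of_nat_eq_0_iff_char_dvd\<close>)
  hence "finite_power_reps m (g ` carrier L)"
    using assms finite_power_reps_finite_subextension[of m to_ac]
    by (intro G.finite_power_reps_T) auto
  hence fin: "finite (carrier (power_classes T.T_ring m))"
    using T.finite_power_reps_T_ring by blast
  have "inj_on g (carrier L)"
    using non_trivial_field_hom_is_inj[OF g L field_from_type_algebra] .
  hence "g \<in> ring_iso L T.T_ring"
    using g by (auto simp: ring_iso_def ring_hom_def bij_betw_def)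
  from ring_iso_finite_power_classes[OF L T.T_ring_field this fin]
  show "finite (carrier (power_classes L m))" .
qed

end
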